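(* Let $A$ be a Banach algebra with unitization $A^\sharp$, and suppose that $A^\sharp$ satisfies the following two conditions: (i) for every unital Banach $A^\sharp$-bimodule $X$, a bounded operator $D\colon A^\sharp\to X$ is a left multiplier if and only if, for all $a,b\in A^\sharp$, $ba=0$ implies $D(b)a=0$; (ii) for every unital Banach $A^\sharp$-bimodule $X$, a bounded operator $D\colon A^\sharp\to X$ is hyperlocal if and only if $D(acb)-aD(cb)-D(ac)b+aD(c)b=0$ for all $a,b,c\in A^\sharp$. Then, for any Banach $A$-bimodule $X$ and any $n\in\mathbb{N}$, every bounded local $n$-cocycle $T$ from $A^{(n)}$ into $X$ is an $n$-cocycle.
   Context: The unitization of a Banach algebra $A$ is $A^\sharp=A\oplus\mathbb{C}$ with product $(a,\lambda)(b,\mu)=(ab+\mu a+\lambda b,\lambda\mu)$ and norm $\|(a,\lambda)\|=\|a\|+|\lambda|$; its unit is $1=(0,1)$. Operators are linear. For a unital Banach algebra $B$, a Banach $B$-bimodule $X$ is unital if $1x=x1=x$ for all $x\in X$. For a Banach algebra $B$ and a Banach $B$-bimodule $X$: an operator $D\colon B\to X$ is a left multiplier if $D(ab)=D(a)b$ for all $a,b\in B$; it is hyperlocal if, for $a_0,a_1,a_2\in B$, $a_0a_1=a_1a_2=0$ implies $a_0D(a_1)a_2=0$. Let $A$ be a Banach algebra and $X$ a Banach $A$-bimodule. For $n\in\mathbb{N}=\{1,2,\dots\}$, $A^{(n)}$ is the Cartesian product of $n$ copies of $A$. For an $n$-linear map $T\colon A^{(n)}\to X$ define $$\delta^nT(a_1,\ldots,a_{n+1})=a_1T(a_2,\ldots,a_{n+1})+\sum_{j=1}^n(-1)^jT(a_1,\ldots,a_{j-1},a_ja_{j+1},\ldots,a_{n+1})+(-1)^{n+1}T(a_1,\ldots,a_n)a_{n+1}.$$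 $T$ is an $n$-cocycle if $\delta^nT=0$ (no boundedness is required). An $n$-linear map $T\colon A^{(n)}\to X$ is a local $n$-cocycle if for each $\tilde a=(a_1,\ldots,a_n)\in A^{(n)}$ there is an $n$-cocycle $T_{\tilde a}\colon A^{(n)}\to X$ (depending on $\tilde a$, not necessarily bounded) such that $T(\tilde a)=T_{\tilde a}(\tilde a)$. If in addition $T$ is bounded as an $n$-linear map, $T$ is a bounded local $n$-cocycle. *)

theory Defs
  imports "HOL-Analysis.Analysis" "HOL-Algebra.Module"
begin

section \<open>Complex Banach algebras\<close>

class complex_banach_algebra = real_normed_algebra + banach +
  fixes scaleC :: "complex \<Rightarrow> 'a \<Rightarrow> 'a" (infixr "*\<^sub>C" 75)
  assumes scaleC_add_right: "c *\<^sub>C (x + y) = c *\<^sub>C x + c *\<^sub>C y"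
    and scaleC_add_left: "(c + d) *\<^sub>C x = c *\<^sub>C x + d *\<^sub>C x"
    and scaleC_scaleC: "c *\<^sub>C d *\<^sub>C x = (c * d) *\<^sub>C x"
    and scaleC_of_real: "complex_of_real r *\<^sub>C x = r *\<^sub>R x"
    and mult_scaleC_left: "(c *\<^sub>C x) * y = c *\<^sub>C (x * y)"
    and mult_scaleC_right: "x * (c *\<^sub>C y) = c *\<^sub>C (x * y)"
    and norm_scaleC: "norm (c *\<^sub>C x) = cmod c * norm x"

lemma scaleC_one [simp]: "1 *\<^sub>C x = (x :: 'a::complex_banach_algebra)"
  using scaleC_of_real[of 1 x] by simp

lemma scaleC_zero_left [simp]: "0 *\<^sub>C x = (0 :: 'a::complex_banach_algebra)"
  using scaleC_of_real[of 0 x] by simp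

lemma scaleC_zero_right [simp]: "c *\<^sub>C 0 = (0 :: 'a::complex_banach_algebra)"
  using scaleC_add_right[of c "0 :: 'a" 0] by simp


section \<open>The unitization\<close>

datatype 'a unitization = Unitization (algebra_part: 'a) (scalar_part: complex)

instantiation unitization :: (complex_banach_algebra) real_algebra
begin

definition "0 = Unitization 0 0"
definition "u + v = Unitization (algebra_part u + algebra_part v) (scalar_part u + scalar_part v)"
definition "- u = Unitization (- algebra_part u) (- scalar_part u)"
definition "u - v = Unitization (algebra_part u - algebra_part v) (scalar_part u - scalar_part v)"
definition "u * v = Unitization
  (algebra_part u * algebra_part v + scalar_part v *\<^sub>C algebra_part u
    + scalar_part u *\<^sub>C algebra_part v)
  (scalar_part u * scalar_part v)"
definition "r *\<^sub>R u = Unitization (r *\<^sub>R algebra_part u) (r *\<^sub>R scalar_part u)"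

lemmas unitization_defs =
  zero_unitization_def plus_unitization_def uminus_unitization_def minus_unitization_def
  times_unitization_def scaleR_unitization_def

instance
proof
  fix u v w :: "'a unitization" and r s :: real
  show "u + v + w = u + (v + w)" "u + v = v + u" "0 + u = u" "- u + u = 0" "u - v = u + - v"
    by (simp_all add: unitization_defs)
  show "r *\<^sub>R (u + v) = r *\<^sub>R u + r *\<^sub>R v" "(r + s) *\<^sub>R u = r *\<^sub>R u + s *\<^sub>R u"
    "r *\<^sub>R s *\<^sub>R u = (r * s) *\<^sub>R u" "1 *\<^sub>R u = u"
    by (simp_all add: unitization_defs scaleR_add_right scaleR_add_left)
  show "u * v * w = u * (v * w)"
    by (simp add: unitization_defs distrib_left distrib_right mult.assoc scaleC_add_right
        scaleC_add_left scaleC_scaleC mult_scaleC_left mult_scaleC_right ac_simps)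
  show "(u + v) * w = u * w + v * w" "u * (v + w) = u * v + u * w"
    by (simp_all add: unitization_defs distrib_left distrib_right scaleC_add_right
        scaleC_add_left add_ac)
  show "r *\<^sub>R u * v = r *\<^sub>R (u * v)" "u * r *\<^sub>R v = r *\<^sub>R (u * v)"
    by (simp_all add: unitization_defs scaleC_of_real [symmetric] scaleC_scaleC
        scaleC_add_right mult_scaleC_left mult_scaleC_right scaleR_conv_of_real ac_simps)
qed

end

instantiation unitization :: (complex_banach_algebra) real_normed_algebra
begin

definition "norm u = norm (algebra_part u) + cmod (scalar_part u)"
definition "sgn (u :: 'a unitization) = u /\<^sub>R norm u"
definition "dist u v = norm (u - v :: 'a unitization)"
definition "uniformity = (INF e\<in>{0 <..}. principal {(u :: 'a unitization, v). dist u v < e})"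
definition "open (U :: 'a unitization set) \<longleftrightarrow>
  (\<forall>u\<in>U. eventually (\<lambda>(u', v). u' = u \<longrightarrow> v \<in> U) uniformity)"

instance
proof
  fix u v :: "'a unitization" and r :: real and U :: "'a unitization set"
  show "norm (r *\<^sub>R u) = \<bar>r\<bar> * norm u"
    by (simp add: unitization_defs norm_unitization_def distrib_left)
  show "norm u = 0 \<longleftrightarrow> u = 0"
    by (cases u) (simp add: unitization_defs norm_unitization_def add_nonneg_eq_0_iff)
  show "norm (u + v) \<le> norm u + norm v"
    using norm_triangle_ineq[of "algebra_part u" "algebra_part v"]
      norm_triangle_ineq[of "scalar_part u" "scalar_part v"]
    by (simp add: unitization_defs norm_unitization_def)
  have "norm (algebra_part u * algebra_part v + scalar_part v *\<^sub>C algebra_part u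
      + scalar_part u *\<^sub>C algebra_part v)
    \<le> norm (algebra_part u * algebra_part v) + norm (scalar_part v *\<^sub>C algebra_part u)
      + norm (scalar_part u *\<^sub>C algebra_part v)"
    by (intro norm_triangle_mono order_refl)
  also have "\<dots> \<le> norm (algebra_part u) * norm (algebra_part v)
      + cmod (scalar_part v) * norm (algebra_part u)
      + cmod (scalar_part u) * norm (algebra_part v)"
    by (simp add: norm_scaleC norm_mult_ineq)
  finally show "norm (u * v) \<le> norm u * norm v"
    by (simp add: unitization_defs norm_unitization_def norm_mult algebra_simps)
  show "sgn u = u /\<^sub>R norm u" "dist u v = norm (u - v)"
    "uniformity = (INF e\<in>{0 <..}. principal {(u :: 'a unitization, v). dist u v < e})"
    "open U \<longleftrightarrow> (\<forall>u\<in>U. eventually (\<lambda>(u', v). u' = u \<longrightarrow> v \<in> U) uniformity)"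
    by (rule sgn_unitization_def dist_unitization_def uniformity_unitization_def
        open_unitization_def)+
qed

end

instance unitization :: (complex_banach_algebra) banach
proof
  fix X :: "nat \<Rightarrow> 'a unitization"
  assume X: "Cauchy X"
  have dist: "dist u v = dist (algebra_part u) (algebra_part v) + dist (scalar_part u) (scalar_part v)"
    for u v :: "'a unitization"
    by (simp add: dist_unitization_def norm_unitization_def minus_unitization_def dist_norm)
  then have "dist (algebra_part u) (algebra_part v) \<le> dist u v"
    "dist (scalar_part u) (scalar_part v) \<le> dist u v" for u v :: "'a unitization"
    by simp_all
  with X have "Cauchy (\<lambda>n. algebra_part (X n))" "Cauchy (\<lambda>n. scalar_part (X n))"
    unfolding Cauchy_def by (meson le_less_trans)+
  then obtain a l where "(\<lambda>n. algebra_part (X n)) \<longlonglongrightarrow> a" "(\<lambda>n. scalar_part (X n)) \<longlonglongrightarrow> l"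
    by (meson Cauchy_convergent convergent_def)
  then have "(\<lambda>n. dist (algebra_part (X n)) a + dist (scalar_part (X n)) l) \<longlonglongrightarrow> 0 + 0"
    by (intro tendsto_add) (simp_all add: tendsto_dist_iff [symmetric])
  then have "X \<longlonglongrightarrow> Unitization a l"
    by (subst tendsto_dist_iff) (simp add: dist)
  then show "convergent X"
    by (auto simp: convergent_def)
qed

instantiation unitization :: (complex_banach_algebra) complex_banach_algebra
begin

definition "c *\<^sub>C u = Unitization (c *\<^sub>C algebra_part u) (c * scalar_part u)"

instance
  by standard
    (simp_all add: unitization_defs norm_unitization_def scaleC_unitization_def scaleC_add_right
      scaleC_add_left scaleC_scaleC scaleC_of_real scaleR_conv_of_real mult_scaleC_left
      mult_scaleC_right norm_scaleC norm_mult distrib_left distrib_right ac_simps)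

end

instantiation unitization :: (complex_banach_algebra) real_normed_algebra_1
begin

definition "1 = Unitization 0 1"

instance
  by standard (simp_all add: unitization_defs norm_unitization_def one_unitization_def)

end


section \<open>Banach bimodules\<close>

definition complex_field :: "complex ring" where
  "complex_field = \<lparr>carrier = UNIV, mult = (*), one = 1, zero = 0, add = (+)\<rparr>"

text \<open>
  Banach bimodules have explicit carriers, so that one can quantify over them inside a formula.
  The components \<open>mult\<close> and \<open>one\<close>, inherited from the record of modules, are irrelevant.
\<close>

record ('b, 'x) bimodule = "(complex, 'x) module" +
  vnorm :: "'x \<Rightarrow> real"
  lact :: "'b \<Rightarrow> 'x \<Rightarrow> 'x"
  ract :: "'x \<Rightarrow> 'b \<Rightarrow> 'x"

locale banach_bimodule = Module.module complex_field X
  for X :: "('b::complex_banach_algebra, 'x) bimodule" (structure) +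
  assumes vnorm_eq_0: "x \<in> carrier X \<Longrightarrow> vnorm X x = 0 \<longleftrightarrow> x = \<zero>"
    and vnorm_triangle: "\<lbrakk>x \<in> carrier X; y \<in> carrier X\<rbrakk> \<Longrightarrow> vnorm X (x \<oplus> y) \<le> vnorm X x + vnorm X y"
    and vnorm_smult: "x \<in> carrier X \<Longrightarrow> vnorm X (c \<odot> x) = cmod c * vnorm X x"
    and complete: "\<lbrakk>\<And>n. s n \<in> carrier X;
        \<forall>e>0. \<exists>N::nat. \<forall>m\<ge>N. \<forall>n\<ge>N. vnorm X (s m \<ominus> s n) < e\<rbrakk>
      \<Longrightarrow> \<exists>x\<in>carrier X. (\<lambda>n. vnorm X (s n \<ominus> x)) \<longlonglongrightarrow> 0"
    and lact_closed: "x \<in> carrier X \<Longrightarrow> lact X a x \<in> carrier X"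
    and lact_add_left: "x \<in> carrier X \<Longrightarrow> lact X (a + b) x = lact X a x \<oplus> lact X b x"
    and lact_scaleC: "x \<in> carrier X \<Longrightarrow> lact X (c *\<^sub>C a) x = c \<odot> lact X a x"
    and lact_add_right:
      "\<lbrakk>x \<in> carrier X; y \<in> carrier X\<rbrakk> \<Longrightarrow> lact X a (x \<oplus> y) = lact X a x \<oplus> lact X a y"
    and lact_smult: "x \<in> carrier X \<Longrightarrow> lact X a (c \<odot> x) = c \<odot> lact X a x"
    and lact_mult: "x \<in> carrier X \<Longrightarrow> lact X (a * b) x = lact X a (lact X b x)"
    and lact_bounded: "\<exists>K. \<forall>a. \<forall>x\<in>carrier X. vnorm X (lact X a x) \<le> K * norm a * vnorm X x"
    and ract_closed: "x \<in> carrier X \<Longrightarrow> ract X x a \<in> carrier X"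
    and ract_add_right: "x \<in> carrier X \<Longrightarrow> ract X x (a + b) = ract X x a \<oplus> ract X x b"
    and ract_scaleC: "x \<in> carrier X \<Longrightarrow> ract X x (c *\<^sub>C a) = c \<odot> ract X x a"
    and ract_add_left:
      "\<lbrakk>x \<in> carrier X; y \<in> carrier X\<rbrakk> \<Longrightarrow> ract X (x \<oplus> y) a = ract X x a \<oplus> ract X y a"
    and ract_smult: "x \<in> carrier X \<Longrightarrow> ract X (c \<odot> x) a = c \<odot> ract X x a"
    and ract_mult: "x \<in> carrier X \<Longrightarrow> ract X x (a * b) = ract X (ract X x a) b"
    and ract_bounded: "\<exists>K. \<forall>a. \<forall>x\<in>carrier X. vnorm X (ract X x a) \<le> K * norm a * vnorm X x"
    and lact_ract: "x \<in> carrier X \<Longrightarrow> ract X (lact X a x) b = lact X a (ract X x b)"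

locale unital_banach_bimodule = banach_bimodule X
  for X :: "('b::{complex_banach_algebra, real_normed_algebra_1}, 'x) bimodule" (structure) +
  assumes lact_one: "x \<in> carrier X \<Longrightarrow> lact X 1 x = x"
    and ract_one: "x \<in> carrier X \<Longrightarrow> ract X x 1 = x"

definition bounded_operator ::
    "('b::complex_banach_algebra, 'x) bimodule \<Rightarrow> ('b \<Rightarrow> 'x) \<Rightarrow> bool" where
  "bounded_operator X D \<longleftrightarrow>
    (\<forall>a. D a \<in> carrier X) \<and>
    (\<forall>a b. D (a + b) = D a \<oplus>\<^bsub>X\<^esub> D b) \<and>
    (\<forall>c a. D (c *\<^sub>C a) = c \<odot>\<^bsub>X\<^esub> D a) \<and>
    (\<exists>K. \<forall>a. vnorm X (D a) \<le> K * norm a)"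

definition left_multiplier ::
    "('b::complex_banach_algebra, 'x) bimodule \<Rightarrow> ('b \<Rightarrow> 'x) \<Rightarrow> bool" where
  "left_multiplier X D \<longleftrightarrow> (\<forall>a b. D (a * b) = ract X (D a) b)"

definition hyperlocal ::
    "('b::complex_banach_algebra, 'x) bimodule \<Rightarrow> ('b \<Rightarrow> 'x) \<Rightarrow> bool" where
  "hyperlocal X D \<longleftrightarrow>
    (\<forall>a0 a1 a2. a0 * a1 = 0 \<and> a1 * a2 = 0 \<longrightarrow> lact X a0 (ract X (D a1) a2) = \<zero>\<^bsub>X\<^esub>)"


section \<open>Cocycles\<close>

text \<open>
  Elements of the \<open>n\<close>-fold Cartesian product are lists of length \<open>n\<close>; the values of maps on lists
  of other lengths are irrelevant. Lists are indexed from 0, so the entry \<open>as ! (j - 1)\<close> is the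
  \<open>j\<close>-th argument.
\<close>

definition n_linear ::
    "nat \<Rightarrow> ('a::complex_banach_algebra, 'x) bimodule \<Rightarrow> ('a list \<Rightarrow> 'x) \<Rightarrow> bool" where
  "n_linear n X T \<longleftrightarrow>
    (\<forall>as. length as = n \<longrightarrow> T as \<in> carrier X) \<and>
    (\<forall>as i a b. length as = n \<and> i < n \<longrightarrow>
      T (as[i := a + b]) = T (as[i := a]) \<oplus>\<^bsub>X\<^esub> T (as[i := b])) \<and>
    (\<forall>as i c a. length as = n \<and> i < n \<longrightarrow> T (as[i := c *\<^sub>C a]) = c \<odot>\<^bsub>X\<^esub> T (as[i := a]))"

definition bounded_n_linear ::
    "nat \<Rightarrow> ('a::complex_banach_algebra, 'x) bimodule \<Rightarrow> ('a list \<Rightarrow> 'x) \<Rightarrow> bool" where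
  "bounded_n_linear n X T \<longleftrightarrow> n_linear n X T \<and>
    (\<exists>K. \<forall>as. length as = n \<longrightarrow> vnorm X (T as) \<le> K * (\<Prod>a\<leftarrow>as. norm a))"

definition merge_args :: "nat \<Rightarrow> 'a::times list \<Rightarrow> 'a list" where
  "merge_args j as = take (j - 1) as @ [as ! (j - 1) * as ! j] @ drop (j + 1) as"

definition coboundary ::
    "nat \<Rightarrow> ('a::complex_banach_algebra, 'x) bimodule \<Rightarrow> ('a list \<Rightarrow> 'x) \<Rightarrow> 'a list \<Rightarrow> 'x" where
  "coboundary n X T as =
    lact X (as ! 0) (T (drop 1 as)) \<oplus>\<^bsub>X\<^esub>
    (\<Oplus>\<^bsub>X\<^esub>j\<in>{1..n}. (- 1) ^ j \<odot>\<^bsub>X\<^esub> T (merge_args j as)) \<oplus>\<^bsub>X\<^esub>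
    (- 1) ^ (n + 1) \<odot>\<^bsub>X\<^esub> ract X (T (take n as)) (as ! n)"

definition cocycle ::
    "nat \<Rightarrow> ('a::complex_banach_algebra, 'x) bimodule \<Rightarrow> ('a list \<Rightarrow> 'x) \<Rightarrow> bool" where
  "cocycle n X T \<longleftrightarrow> n_linear n X T \<and>
    (\<forall>as. length as = n + 1 \<longrightarrow> coboundary n X T as = \<zero>\<^bsub>X\<^esub>)"

definition local_cocycle ::
    "nat \<Rightarrow> ('a::complex_banach_algebra, 'x) bimodule \<Rightarrow> ('a list \<Rightarrow> 'x) \<Rightarrow> bool" where
  "local_cocycle n X T \<longleftrightarrow> n_linear n X T \<and>
    (\<forall>as. length as = n \<longrightarrow> (\<exists>S. cocycle n X S \<and> T as = S as))"

definition bounded_local_cocycle ::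
    "nat \<Rightarrow> ('a::complex_banach_algebra, 'x) bimodule \<Rightarrow> ('a list \<Rightarrow> 'x) \<Rightarrow> bool" where
  "bounded_local_cocycle n X T \<longleftrightarrow> local_cocycle n X T \<and> bounded_n_linear n X T"


section \<open>Quantification over all unital bimodules\<close>

text \<open>
  A formula can only quantify over bimodules whose carriers lie in one fixed type. The type below
  is large enough, for a given algebra, to lose no generality in statements about a single bounded
  operator \<open>D\<close>: an operator only sees the closed sub-bimodule generated by its range, and an
  element of that sub-bimodule is the limit of a sequence of finite sums of terms
  \<open>a \<cdot> D b \<cdot> c\<close>, hence is coded by a sequence of lists of triples. The two lemmas at the end make
  this precise: each condition for carriers in this type implies the same condition for unital
  Banach bimodules with carrier in an arbitrary type.
\<close>

type_synonym 'b bimodule_universe = "nat \<Rightarrow> ('b \<times> 'b \<times> 'b) list"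

lemma complex_field_simps [simp]:
  "carrier complex_field = UNIV" "mult complex_field = (*)" "one complex_field = 1"
  "zero complex_field = 0" "add complex_field = (+)"
  by (simp_all add: complex_field_def)

lemma cring_complex_field: "cring complex_field"
  by (rule cringI, rule abelian_groupI, auto intro!: comm_monoidI simp: algebra_simps)
    (metis add.right_inverse)

lemma complex_field_a_inv [simp]: "\<ominus>\<^bsub>complex_field\<^esub> c = - c"
proof -
  interpret cring complex_field by (rule cring_complex_field)
  show ?thesis
    using minus_equality[of "- c" c] by simp
qed

context banach_bimodule
begin

lemma vnorm_zero [simp]: "vnorm X \<zero> = 0"
  using vnorm_eq_0 by blast

lemma vnorm_minus: "x \<in> carrier X \<Longrightarrow> vnorm X (\<ominus> x) = vnorm X x"
  using vnorm_smult[of x "- 1"] smult_l_minus[of 1 x] smult_one[of x] by simp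

lemma vnorm_nonneg: "x \<in> carrier X \<Longrightarrow> 0 \<le> vnorm X x"
  using vnorm_triangle[of x "\<ominus> x"] vnorm_minus[of x] M.r_neg[of x] by simp

lemma smult_closed' [simp, intro]: "x \<in> carrier X \<Longrightarrow> c \<odot> x \<in> carrier X"
  by simp

lemma vnorm_minus_commute:
  assumes "x \<in> carrier X" "y \<in> carrier X"
  shows "vnorm X (x \<ominus> y) = vnorm X (y \<ominus> x)"
proof -
  have "\<ominus> (x \<ominus> y) = y \<ominus> x"
    using assms by (simp add: a_minus_def M.minus_add M.a_comm)
  then show ?thesis
    using assms vnorm_minus[of "x \<ominus> y"] by simp
qed

lemma vnorm_diff_triangle:
  assumes "x \<in> carrier X" "y \<in> carrier X" "z \<in> carrier X"
  shows "vnorm X (x \<ominus> z) \<le> vnorm X (x \<ominus> y) + vnorm X (y \<ominus> z)"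
proof -
  have "x \<ominus> z = (x \<ominus> y) \<oplus> (y \<ominus> z)"
    using assms by (simp add: a_minus_def M.a_assoc M.r_neg1)
  then show ?thesis
    using assms vnorm_triangle[of "x \<ominus> y" "y \<ominus> z"] by simp
qed

lemma add_diff_add:
  assumes "x \<in> carrier X" "y \<in> carrier X" "x' \<in> carrier X" "y' \<in> carrier X"
  shows "(x \<oplus> y) \<ominus> (x' \<oplus> y') = (x \<ominus> x') \<oplus> (y \<ominus> y')"
  using assms by (simp add: a_minus_def M.minus_add M.a_ac)

lemma smult_diff:
  assumes "x \<in> carrier X" "y \<in> carrier X"
  shows "c \<odot> x \<ominus> c \<odot> y = c \<odot> (x \<ominus> y)"
  using assms by (simp add: a_minus_def smult_r_distr smult_r_minus)

lemma minus_eq_smult: "x \<in> carrier X \<Longrightarrow> \<ominus> x = (- 1) \<odot> x"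
  using smult_l_minus[of 1 x] smult_one[of x] by simp

lemma lact_diff:
  assumes "x \<in> carrier X" "y \<in> carrier X"
  shows "lact X a x \<ominus> lact X a y = lact X a (x \<ominus> y)"
  using assms by (simp add: a_minus_def minus_eq_smult lact_add_right lact_smult lact_closed)

lemma ract_diff:
  assumes "x \<in> carrier X" "y \<in> carrier X"
  shows "ract X x a \<ominus> ract X y a = ract X (x \<ominus> y) a"
  using assms by (simp add: a_minus_def minus_eq_smult ract_add_left ract_smult ract_closed)

definition tends :: "(nat \<Rightarrow> 'x) \<Rightarrow> 'x \<Rightarrow> bool" where
  "tends s x \<longleftrightarrow> (\<forall>n. s n \<in> carrier X) \<and> x \<in> carrier X \<and> (\<lambda>n. vnorm X (s n \<ominus> x)) \<longlonglongrightarrow> 0"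

lemma tendsI:
  assumes "\<And>n. s n \<in> carrier X" "x \<in> carrier X" "f \<longlonglongrightarrow> 0"
    "\<And>n. vnorm X (s n \<ominus> x) \<le> f n"
  shows "tends s x"
  unfolding tends_def
proof (intro conjI allI)
  show "(\<lambda>n. vnorm X (s n \<ominus> x)) \<longlonglongrightarrow> 0"
    using assms(1,2,4) vnorm_nonneg[of "s _ \<ominus> x"]
    by (intro tendsto_sandwich[OF _ _ tendsto_const assms(3)]) (auto intro!: always_eventually)
qed (use assms in auto)

lemma tends_unique:
  assumes "tends s x" "tends s y"
  shows "x = y"
proof -
  have cl: "x \<in> carrier X" "y \<in> carrier X" "\<And>n. s n \<in> carrier X"
    using assms by (auto simp: tends_def)
  have "(\<lambda>n. vnorm X (s n \<ominus> x) + vnorm X (s n \<ominus> y)) \<longlonglongrightarrow> 0 + 0"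
    using assms by (intro tendsto_add) (auto simp: tends_def)
  moreover have "vnorm X (x \<ominus> y) \<le> vnorm X (s n \<ominus> x) + vnorm X (s n \<ominus> y)" for n
    using vnorm_diff_triangle[of x "s n" y] vnorm_minus_commute[of x "s n"] cl by simp
  ultimately have "vnorm X (x \<ominus> y) \<le> 0 + 0"
    by (intro LIMSEQ_le_const) auto
  then have "vnorm X (x \<ominus> y) = 0"
    using cl vnorm_nonneg[of "x \<ominus> y"] by simp
  then have "x \<ominus> y = \<zero>"
    using cl vnorm_eq_0 by simp
  then show ?thesis
    using cl M.minus_equality[of x "\<ominus> y"] by (simp add: a_minus_def)
qed

lemma tends_add:
  assumes "tends s x" "tends t y"
  shows "tends (\<lambda>n. s n \<oplus> t n) (x \<oplus> y)"
proof (rule tendsI)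
  show "(\<lambda>n. vnorm X (s n \<ominus> x) + vnorm X (t n \<ominus> y)) \<longlonglongrightarrow> 0"
    using tendsto_add[of "\<lambda>n. vnorm X (s n \<ominus> x)" 0 sequentially "\<lambda>n. vnorm X (t n \<ominus> y)" 0] assms
    by (simp add: tends_def)
  show "vnorm X (s n \<oplus> t n \<ominus> (x \<oplus> y)) \<le> vnorm X (s n \<ominus> x) + vnorm X (t n \<ominus> y)" for n
    using assms by (simp add: tends_def add_diff_add vnorm_triangle)
qed (use assms in \<open>auto simp: tends_def\<close>)

lemma tends_map:
  assumes "tends s x" "\<And>y. y \<in> carrier X \<Longrightarrow> f y \<in> carrier X"
    "\<And>y. y \<in> carrier X \<Longrightarrow> vnorm X (f y) \<le> K * vnorm X y"
    "\<And>y z. \<lbrakk>y \<in> carrier X; z \<in> carrier X\<rbrakk> \<Longrightarrow> f y \<ominus> f z = f (y \<ominus> z)"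
  shows "tends (\<lambda>n. f (s n)) (f x)"
proof (rule tendsI)
  show "(\<lambda>n. K * vnorm X (s n \<ominus> x)) \<longlonglongrightarrow> 0"
    using tendsto_mult_left[of "\<lambda>n. vnorm X (s n \<ominus> x)" 0 sequentially K] assms(1)
    by (simp add: tends_def)
qed (use assms in \<open>auto simp: tends_def\<close>)

lemma tends_smult: "tends s x \<Longrightarrow> tends (\<lambda>n. c \<odot> s n) (c \<odot> x)"
  by (rule tends_map[where f = "\<lambda>y. c \<odot> y" and K = "cmod c"]) (auto simp: vnorm_smult smult_diff)

lemma tends_lact: "tends s x \<Longrightarrow> tends (\<lambda>n. lact X a (s n)) (lact X a x)"
proof -
  obtain K where K: "\<And>a x. x \<in> carrier X \<Longrightarrow> vnorm X (lact X a x) \<le> K * norm a * vnorm X x"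
    using lact_bounded by auto
  assume "tends s x" then show ?thesis
    by (rule tends_map[where f = "\<lambda>y. lact X a y" and K = "K * norm a"])
      (auto simp: K lact_diff lact_closed)
qed

lemma tends_ract: "tends s x \<Longrightarrow> tends (\<lambda>n. ract X (s n) a) (ract X x a)"
proof -
  obtain K where K: "\<And>a x. x \<in> carrier X \<Longrightarrow> vnorm X (ract X x a) \<le> K * norm a * vnorm X x"
    using ract_bounded by auto
  assume "tends s x" then show ?thesis
    by (rule tends_map[where f = "\<lambda>y. ract X y a" and K = "K * norm a"])
      (auto simp: K ract_diff ract_closed)
qed

definition transported :: "'x set \<Rightarrow> ('x \<Rightarrow> 'u) \<Rightarrow> ('b, 'u) bimodule" where
  "transported Y f =
    \<lparr>carrier = f ` Y, mult = undefined, one = undefined, zero = f \<zero>,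
     add = (\<lambda>u v. f (inv_into Y f u \<oplus> inv_into Y f v)),
     smult = (\<lambda>c u. f (c \<odot> inv_into Y f u)),
     vnorm = (\<lambda>u. vnorm X (inv_into Y f u)),
     lact = (\<lambda>a u. f (lact X a (inv_into Y f u))),
     ract = (\<lambda>u a. f (ract X (inv_into Y f u) a))\<rparr>"

lemma transported_simps [simp]:
  "carrier (transported Y f) = f ` Y" "zero (transported Y f) = f \<zero>"
  "add (transported Y f) u v = f (inv_into Y f u \<oplus> inv_into Y f v)"
  "smult (transported Y f) c u = f (c \<odot> inv_into Y f u)"
  "vnorm (transported Y f) u = vnorm X (inv_into Y f u)"
  "lact (transported Y f) a u = f (lact X a (inv_into Y f u))"
  "ract (transported Y f) u a = f (ract X (inv_into Y f u) a)"
  by (simp_all add: transported_def)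

lemma banach_bimodule_transported:
  assumes sub: "Y \<subseteq> carrier X" and inj: "inj_on f Y" and zero: "\<zero> \<in> Y"
    and add: "\<And>x y. \<lbrakk>x \<in> Y; y \<in> Y\<rbrakk> \<Longrightarrow> x \<oplus> y \<in> Y"
    and smult: "\<And>c x. x \<in> Y \<Longrightarrow> c \<odot> x \<in> Y"
    and lact: "\<And>a x. x \<in> Y \<Longrightarrow> lact X a x \<in> Y"
    and ract: "\<And>a x. x \<in> Y \<Longrightarrow> ract X x a \<in> Y"
    and closed: "\<And>s x. \<lbrakk>tends s x; \<And>n. s n \<in> Y\<rbrakk> \<Longrightarrow> x \<in> Y"
  shows "banach_bimodule (transported Y f)"
proof -
  note [simp] = inv_into_f_f[OF inj]
  have cl [simp, intro]: "x \<in> Y \<Longrightarrow> x \<in> carrier X" for x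
    using sub by auto
  note [simp, intro] = zero add smult lact ract
  have minusY: "\<ominus> x \<in> Y" if "x \<in> Y" for x
    using that by (simp add: minus_eq_smult)
  have ag: "abelian_group (transported Y f)"
  proof (rule abelian_groupI)
    fix u assume "u \<in> carrier (transported Y f)"
    then obtain x where x: "x \<in> Y" "u = f x" by auto
    then have "f (\<ominus> x) \<oplus>\<^bsub>transported Y f\<^esub> u = \<zero>\<^bsub>transported Y f\<^esub>"
      using minusY by (simp add: M.l_neg)
    then show "\<exists>v\<in>carrier (transported Y f). v \<oplus>\<^bsub>transported Y f\<^esub> u = \<zero>\<^bsub>transported Y f\<^esub>"
      using x minusY by (intro bexI[of _ "f (\<ominus> x)"]) auto
  qed (auto simp: M.a_ac)
  interpret Z: abelian_group "transported Y f" by (rule ag)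
  have neg: "\<ominus>\<^bsub>transported Y f\<^esub> (f x) = f (\<ominus> x)" if "x \<in> Y" for x
    using that by (intro Z.minus_equality) (auto simp: M.l_neg minusY)
  have diff: "f x \<ominus>\<^bsub>transported Y f\<^esub> f y = f (x \<ominus> y)" if "x \<in> Y" "y \<in> Y" for x y
    using that by (simp add: a_minus_def neg minusY)
  have diffY [simp, intro]: "x \<ominus> y \<in> Y" if "x \<in> Y" "y \<in> Y" for x y
    using that by (simp add: a_minus_def minusY)
  have mod: "Module.module complex_field (transported Y f)"
    by (rule moduleI[OF cring_complex_field ag])
      (auto simp: smult_l_distr[simplified] smult_r_distr[simplified] smult_assoc1[simplified] smult_one[simplified])
  show ?thesis
  proof (intro banach_bimodule.intro mod banach_bimodule_axioms.intro)
    fix s :: "nat \<Rightarrow> _"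
    assume s: "\<And>n. s n \<in> carrier (transported Y f)"
      and Cauchy: "\<forall>e>0. \<exists>N. \<forall>m\<ge>N. \<forall>n\<ge>N.
        vnorm (transported Y f) (s m \<ominus>\<^bsub>transported Y f\<^esub> s n) < e"
    define t where "t n = inv_into Y f (s n)" for n
    have t: "t n \<in> Y" "s n = f (t n)" for n
      using s[of n] by (auto simp: t_def)
    have "\<forall>e>0. \<exists>N. \<forall>m\<ge>N. \<forall>n\<ge>N. vnorm X (t m \<ominus> t n) < e"
      using Cauchy t by (simp add: diff)
    then obtain x where x: "x \<in> carrier X" "(\<lambda>n. vnorm X (t n \<ominus> x)) \<longlonglongrightarrow> 0"
      using complete[of t] t by auto
    then have "x \<in> Y"
      using closed[of t x] t by (auto simp: tends_def)
    with x t show "\<exists>u\<in>carrier (transported Y f).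
        (\<lambda>n. vnorm (transported Y f) (s n \<ominus>\<^bsub>transported Y f\<^esub> u)) \<longlonglongrightarrow> 0"
      by (auto simp: diff intro!: bexI[of _ x])
  next
    show "\<exists>K. \<forall>a. \<forall>x\<in>carrier (transported Y f).
        vnorm (transported Y f) (lact (transported Y f) a x) \<le> K * norm a * vnorm (transported Y f) x"
    proof -
      obtain K where "\<And>a x. x \<in> carrier X \<Longrightarrow> vnorm X (lact X a x) \<le> K * norm a * vnorm X x"
        using lact_bounded by auto
      then show ?thesis
        by (intro exI[of _ K]) auto
    qed
    show "\<exists>K. \<forall>a. \<forall>x\<in>carrier (transported Y f).
        vnorm (transported Y f) (ract (transported Y f) x a) \<le> K * norm a * vnorm (transported Y f) x"
    proof -
      obtain K where "\<And>a x. x \<in> carrier X \<Longrightarrow> vnorm X (ract X x a) \<le> K * norm a * vnorm X x"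
        using ract_bounded by auto
      then show ?thesis
        by (intro exI[of _ K]) auto
    qed
  qed (auto simp: vnorm_eq_0 vnorm_triangle vnorm_smult lact_add_left lact_scaleC lact_add_right
      lact_smult lact_mult ract_add_right ract_scaleC ract_add_left ract_smult ract_mult lact_ract
      inj_on_eq_iff[OF inj])
qed

primrec eval_code :: "('b \<Rightarrow> 'x) \<Rightarrow> ('b \<times> 'b \<times> 'b) list \<Rightarrow> 'x" where
  "eval_code D [] = \<zero>"
| "eval_code D (p # ps) =
    lact X (fst p) (ract X (D (fst (snd p))) (snd (snd p))) \<oplus> eval_code D ps"

end

lemma (in unital_banach_bimodule) generated_sub_bimodule:
  assumes D: "bounded_operator X D"
  obtains Y :: "'x set" and f :: "'x \<Rightarrow> 'b bimodule_universe" where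
    "Y \<subseteq> carrier X" "inj_on f Y" "\<zero> \<in> Y" "range D \<subseteq> Y"
    "\<And>x y. \<lbrakk>x \<in> Y; y \<in> Y\<rbrakk> \<Longrightarrow> x \<oplus> y \<in> Y" "\<And>c x. x \<in> Y \<Longrightarrow> c \<odot> x \<in> Y"
    "\<And>a x. x \<in> Y \<Longrightarrow> lact X a x \<in> Y" "\<And>a x. x \<in> Y \<Longrightarrow> ract X x a \<in> Y"
    "unital_banach_bimodule (transported Y f)"
    "bounded_operator (transported Y f) (f \<circ> D)"
proof -
  have Dcl [simp, intro]: "D a \<in> carrier X" for a
    using D by (simp add: bounded_operator_def)
  note [simp, intro] = lact_closed ract_closed
  let ?e = "eval_code D"
  have ecl [simp, intro]: "?e l \<in> carrier X" for l
    by (induction l) auto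
  have e_append: "?e (l @ m) = ?e l \<oplus> ?e m" for l m
    by (induction l) (auto simp: M.a_assoc)
  have e_smult: "?e (map (\<lambda>p. (c *\<^sub>C fst p, snd p)) l) = c \<odot> ?e l" for c l
    by (induction l) (auto simp: lact_scaleC smult_r_distr[simplified])
  have e_lact: "?e (map (\<lambda>p. (a * fst p, snd p)) l) = lact X a (?e l)" for a l
    using lact_smult[of "\<zero>" a 0] smult_l_null
    by (induction l) (auto simp: lact_mult lact_add_right)
  have e_ract: "?e (map (\<lambda>p. (fst p, fst (snd p), snd (snd p) * a)) l) = ract X (?e l) a" for a l
    using ract_smult[of "\<zero>" 0 a] smult_l_null
    by (induction l) (auto simp: ract_mult ract_add_left lact_ract)
  define Y where "Y = {x. \<exists>s. tends (\<lambda>n. ?e (s n)) x}"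
  define f where "f x = (SOME s. tends (\<lambda>n. ?e (s n)) x)" for x
  have Y_cl: "Y \<subseteq> carrier X"
    by (auto simp: Y_def tends_def)
  have f: "tends (\<lambda>n. ?e (f x n)) x" if "x \<in> Y" for x
    using that someI_ex[of "\<lambda>s. tends (\<lambda>n. ?e (s n)) x"] by (auto simp: Y_def f_def)
  have inj: "inj_on f Y"
    using f tends_unique by (metis inj_onI)
  have e_Y: "?e l \<in> Y" for l
    unfolding Y_def by (auto intro!: exI[of _ "\<lambda>_. l"] simp: tends_def M.r_neg a_minus_def)
  have zero: "\<zero> \<in> Y"
    using e_Y[of "[]"] by simp
  have range: "range D \<subseteq> Y"
    using e_Y[of "[(1, _, 1)]"] by (auto simp: lact_one ract_one)
  have add: "x \<oplus> y \<in> Y" if "x \<in> Y" "y \<in> Y" for x y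
    using tends_add[OF f[OF that(1)] f[OF that(2)]] unfolding Y_def
    by (auto intro!: exI[of _ "\<lambda>n. f x n @ f y n"] simp: e_append)
  have smult: "c \<odot> x \<in> Y" if "x \<in> Y" for c x
    using tends_smult[OF f[OF that], of c] unfolding Y_def
    by (auto intro!: exI[of _ "\<lambda>n. map (\<lambda>p. (c *\<^sub>C fst p, snd p)) (f x n)"] simp: e_smult)
  have lact: "lact X a x \<in> Y" if "x \<in> Y" for a x
    using tends_lact[OF f[OF that], of a] unfolding Y_def
    by (auto intro!: exI[of _ "\<lambda>n. map (\<lambda>p. (a * fst p, snd p)) (f x n)"] simp: e_lact)
  have ract: "ract X x a \<in> Y" if "x \<in> Y" for a x
    using tends_ract[OF f[OF that], of a] unfolding Y_def
    by (auto intro!: exI[of _ "\<lambda>n. map (\<lambda>p. (fst p, fst (snd p), snd (snd p) * a)) (f x n)"]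
        simp: e_ract)
  have closed: "x \<in> Y" if s: "tends s x" "\<And>n. s n \<in> Y" for s x
  proof -
    have "\<exists>l. vnorm X (?e l \<ominus> s n) < 1 / real (Suc n)" for n
    proof -
      have "(\<lambda>k. vnorm X (?e (f (s n) k) \<ominus> s n)) \<longlonglongrightarrow> 0"
        using f[OF s(2)[of n]] by (simp add: tends_def)
      then have "eventually (\<lambda>k. vnorm X (?e (f (s n) k) \<ominus> s n) < 1 / real (Suc n)) sequentially"
        by (rule order_tendstoD) simp
      then show ?thesis
        by (auto simp: eventually_sequentially)
    qed
    then obtain l where l: "\<And>n. vnorm X (?e (l n) \<ominus> s n) < 1 / real (Suc n)"
      by metis
    have "tends (\<lambda>n. ?e (l n)) x"
    proof (rule tendsI)
      show "(\<lambda>n. 1 / real (Suc n) + vnorm X (s n \<ominus> x)) \<longlonglongrightarrow> 0"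
        using tendsto_add[OF LIMSEQ_Suc[OF lim_1_over_n], of "\<lambda>n. vnorm X (s n \<ominus> x)" 0] s(1)
        by (simp add: tends_def)
      show "vnorm X (?e (l n) \<ominus> x) \<le> 1 / real (Suc n) + vnorm X (s n \<ominus> x)" for n
        using vnorm_diff_triangle[of "?e (l n)" "s n" x] l[of n] s by (auto simp: tends_def)
    qed (use s in \<open>auto simp: tends_def\<close>)
    then show ?thesis
      by (auto simp: Y_def)
  qed
  have ban: "banach_bimodule (transported Y f)"
    by (rule banach_bimodule_transported) (fact Y_cl inj zero add smult lact ract closed)+
  have uni: "unital_banach_bimodule (transported Y f)"
    using Y_cl inj
    by (intro unital_banach_bimodule.intro ban unital_banach_bimodule_axioms.intro)
      (auto simp: lact_one ract_one subset_iff)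
  have DY: "D a \<in> Y" for a
    using range by auto
  have bop: "bounded_operator (transported Y f) (f \<circ> D)"
    using D DY by (auto simp: bounded_operator_def inv_into_f_f[OF inj])
  show thesis
    by (rule that) (fact Y_cl inj zero range add smult lact ract uni bop)+
qed

lemma left_multiplier_condition_any_carrier:
  assumes cond: "\<And>(X :: ('b::{complex_banach_algebra, real_normed_algebra_1}, 'b bimodule_universe) bimodule) D.
      \<lbrakk>unital_banach_bimodule X; bounded_operator X D\<rbrakk>
      \<Longrightarrow> left_multiplier X D \<longleftrightarrow> (\<forall>a b. b * a = 0 \<longrightarrow> ract X (D b) a = \<zero>\<^bsub>X\<^esub>)"
    and X: "unital_banach_bimodule (X :: ('b, 'x) bimodule)" and D: "bounded_operator X D"
  shows "left_multiplier X D \<longleftrightarrow> (\<forall>a b. b * a = 0 \<longrightarrow> ract X (D b) a = \<zero>\<^bsub>X\<^esub>)"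
proof -
  interpret unital_banach_bimodule X by (rule X)
  obtain Y and f :: "'x \<Rightarrow> 'b bimodule_universe" where Y:
    "Y \<subseteq> carrier X" "inj_on f Y" "\<zero>\<^bsub>X\<^esub> \<in> Y" "range D \<subseteq> Y"
    "\<And>x y. \<lbrakk>x \<in> Y; y \<in> Y\<rbrakk> \<Longrightarrow> x \<oplus>\<^bsub>X\<^esub> y \<in> Y" "\<And>c x. x \<in> Y \<Longrightarrow> c \<odot>\<^bsub>X\<^esub> x \<in> Y"
    "\<And>a x. x \<in> Y \<Longrightarrow> lact X a x \<in> Y" "\<And>a x. x \<in> Y \<Longrightarrow> ract X x a \<in> Y"
    and *: "unital_banach_bimodule (transported Y f)" "bounded_operator (transported Y f) (f \<circ> D)"
    by (rule generated_sub_bimodule[OF D]) (rule that)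
  have DY: "D a \<in> Y" for a
    using Y(4) by auto
  show ?thesis
    using cond[OF *] DY Y(3,8)
    by (simp add: left_multiplier_def inv_into_f_f[OF Y(2)] inj_on_eq_iff[OF Y(2)])
qed

lemma hyperlocal_condition_any_carrier:
  assumes cond: "\<And>(X :: ('b::{complex_banach_algebra, real_normed_algebra_1}, 'b bimodule_universe) bimodule) D.
      \<lbrakk>unital_banach_bimodule X; bounded_operator X D\<rbrakk>
      \<Longrightarrow> hyperlocal X D \<longleftrightarrow>
        (\<forall>a b c. D (a * c * b) \<ominus>\<^bsub>X\<^esub> lact X a (D (c * b)) \<ominus>\<^bsub>X\<^esub> ract X (D (a * c)) b
          \<oplus>\<^bsub>X\<^esub> lact X a (ract X (D c) b) = \<zero>\<^bsub>X\<^esub>)"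
    and X: "unital_banach_bimodule (X :: ('b, 'x) bimodule)" and D: "bounded_operator X D"
  shows "hyperlocal X D \<longleftrightarrow>
    (\<forall>a b c. D (a * c * b) \<ominus>\<^bsub>X\<^esub> lact X a (D (c * b)) \<ominus>\<^bsub>X\<^esub> ract X (D (a * c)) b
      \<oplus>\<^bsub>X\<^esub> lact X a (ract X (D c) b) = \<zero>\<^bsub>X\<^esub>)"
proof -
  interpret unital_banach_bimodule X by (rule X)
  obtain Y and f :: "'x \<Rightarrow> 'b bimodule_universe" where Y:
    "Y \<subseteq> carrier X" "inj_on f Y" "\<zero>\<^bsub>X\<^esub> \<in> Y" "range D \<subseteq> Y"
    "\<And>x y. \<lbrakk>x \<in> Y; y \<in> Y\<rbrakk> \<Longrightarrow> x \<oplus>\<^bsub>X\<^esub> y \<in> Y" "\<And>c x. x \<in> Y \<Longrightarrow> c \<odot>\<^bsub>X\<^esub> x \<in> Y"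
    "\<And>a x. x \<in> Y \<Longrightarrow> lact X a x \<in> Y" "\<And>a x. x \<in> Y \<Longrightarrow> ract X x a \<in> Y"
    and *: "unital_banach_bimodule (transported Y f)" "bounded_operator (transported Y f) (f \<circ> D)"
    by (rule generated_sub_bimodule[OF D]) (rule that)
  interpret Z: unital_banach_bimodule "transported Y f" by (rule *(1))
  have DY: "D a \<in> Y" for a
    using Y(4) by auto
  have minusY: "\<ominus>\<^bsub>X\<^esub> x \<in> Y" if "x \<in> Y" for x
    using that Y(1,6) by (auto simp: minus_eq_smult)
  have neg: "\<ominus>\<^bsub>transported Y f\<^esub> (f x) = f (\<ominus>\<^bsub>X\<^esub> x)" if "x \<in> Y" for x
    using that minusY[OF that] Y(1)
    by (intro Z.M.minus_equality) (auto simp: M.l_neg inv_into_f_f[OF Y(2)])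
  have diff: "f x \<ominus>\<^bsub>transported Y f\<^esub> f y = f (x \<ominus>\<^bsub>X\<^esub> y)" if "x \<in> Y" "y \<in> Y" for x y
    using that minusY by (simp add: a_minus_def neg inv_into_f_f[OF Y(2)])
  have diffY: "x \<ominus>\<^bsub>X\<^esub> y \<in> Y" if "x \<in> Y" "y \<in> Y" for x y
    using that minusY Y(5) by (simp add: a_minus_def)
  show ?thesis
    using cond[OF *] DY Y(3,5,7,8) diffY
    by (simp add: hyperlocal_def inv_into_f_f[OF Y(2)] inj_on_eq_iff[OF Y(2)] diff)
qed

end

theory Submission
  imports Defs
begin

text \<open>
  Extending a local \<open>n\<close>-cocycle by zero on the adjoined unit gives a bounded multilinear map \<open>T\<close>
  on the unitization that vanishes when some argument is \<open>1\<close>. The cocycle identity, applied to the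
  cocycles that agree with \<open>T\<close> at single points, shows that \<open>a\<^sub>0 T(a\<^sub>1, \<dots>, a\<^sub>n) a\<^sub>n\<^sub>+\<^sub>1 = 0\<close>
  whenever all products \<open>a\<^sub>j a\<^sub>j\<^sub>+\<^sub>1\<close> vanish. Such maps are cocycles, by induction on \<open>n\<close>. For \<open>n
  = 1\<close>, condition (ii) with \<open>c = 1\<close> and \<open>T(1) = 0\<close> says that \<open>T\<close> is a derivation. In general, let
  \<open>H\<close> be the bimodule of bounded operators \<open>S\<close> with \<open>S(1) = 0\<close>, with actions \<open>(a\<cdot>S)(b) = a S(b)\<close>
  and \<open>(S\<cdot>a)(b) = S(ab) - S(a) b\<close>; it is unital because of the normalisation. Fixing all arguments
  but the last makes \<open>T\<close> an \<open>(n - 1)\<close>-linear map into \<open>H\<close> with the same coboundary. Condition (i),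
  applied to \<open>b \<mapsto> a\<^sub>0 T(a\<^sub>1, \<dots>, a\<^sub>n\<^sub>-\<^sub>1, a\<^sub>n b)\<close>, shows that this map again satisfies the zero
  product property.
\<close>

section \<open>The bimodule of bounded operators\<close>

text \<open>The least bound constant. Requiring \<open>0 \<le> K\<close> keeps the set bounded below
  even over a trivial algebra, where every \<open>norm b\<close> is 0.\<close>

definition op_norm :: "('b::complex_banach_algebra, 'x) bimodule \<Rightarrow> ('b \<Rightarrow> 'x) \<Rightarrow> real" where
  "op_norm X S = Inf {K. 0 \<le> K \<and> (\<forall>b. vnorm X (S b) \<le> K * norm b)}"

lemma op_norm_le:
  assumes "0 \<le> K" "\<And>b. vnorm X (S b) \<le> K * norm b"
  shows "op_norm X S \<le> K"
  unfolding op_norm_def by (rule cInf_lower) (use assms in \<open>auto intro!: bdd_belowI[of _ 0]\<close>)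

text \<open>The right action measures how far \<open>S\<close> is from being a left multiplier at
  \<open>a\<close>. Over a unital \<open>X\<close> its value at 1 is S(a) - S(a) 1 = 0, so it
  preserves the normalisation; and S(1) = 0 makes 1 act as the identity.\<close>

definition hom_bimodule ::
    "('b::{complex_banach_algebra, real_normed_algebra_1}, 'x) bimodule \<Rightarrow> ('b, 'b \<Rightarrow> 'x) bimodule"
        where
  "hom_bimodule X =
    \<lparr>carrier = {S. bounded_operator X S \<and> S 1 = \<zero>\<^bsub>X\<^esub>}, mult = undefined, one = undefined,
     zero = (\<lambda>b. \<zero>\<^bsub>X\<^esub>),
     add = (\<lambda>S S' b. S b \<oplus>\<^bsub>X\<^esub> S' b),
     smult = (\<lambda>c S b. c \<odot>\<^bsub>X\<^esub> S b),
     vnorm = op_norm X,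
     lact = (\<lambda>a S b. lact X a (S b)),
     ract = (\<lambda>S a b. S (a * b) \<ominus>\<^bsub>X\<^esub> ract X (S a) b)\<rparr>"

lemma hom_bimodule_simps [simp]:
  "carrier (hom_bimodule X) = {S. bounded_operator X S \<and> S 1 = \<zero>\<^bsub>X\<^esub>}"
  "zero (hom_bimodule X) = (\<lambda>b. \<zero>\<^bsub>X\<^esub>)"
  "add (hom_bimodule X) S S' = (\<lambda>b. S b \<oplus>\<^bsub>X\<^esub> S' b)"
  "smult (hom_bimodule X) c S = (\<lambda>b. c \<odot>\<^bsub>X\<^esub> S b)"
  "vnorm (hom_bimodule X) = op_norm X"
  "lact (hom_bimodule X) a S = (\<lambda>b. lact X a (S b))"
  "ract (hom_bimodule X) S a = (\<lambda>b. S (a * b) \<ominus>\<^bsub>X\<^esub> ract X (S a) b)"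
  by (simp_all add: hom_bimodule_def)

section \<open>Elementary identities and operator norm estimates\<close>

context banach_bimodule
begin

lemma diff_eq_smult:
  "\<lbrakk>x \<in> carrier X; y \<in> carrier X\<rbrakk> \<Longrightarrow> x \<ominus> y = x \<oplus> (- 1) \<odot> y"
  by (simp add: a_minus_def minus_eq_smult)

lemma diff_self: "x \<in> carrier X \<Longrightarrow> x \<ominus> x = \<zero>"
  by (simp add: a_minus_def M.r_neg)

lemma lact_zero [simp]: "lact X a \<zero> = \<zero>"
  using lact_smult[of \<zero> a 0] lact_closed[of \<zero> a] smult_l_null by simp

lemma ract_zero [simp]: "ract X \<zero> a = \<zero>"
  using ract_smult[of \<zero> 0 a] ract_closed[of \<zero> a] smult_l_null by simp

lemma lact_by_zero [simp]: "x \<in> carrier X \<Longrightarrow> lact X 0 x = \<zero>"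
  using lact_scaleC[of x 0 0] smult_l_null lact_closed by simp

lemma ract_by_zero [simp]: "x \<in> carrier X \<Longrightarrow> ract X x 0 = \<zero>"
  using ract_scaleC[of x 0 0] smult_l_null ract_closed by simp

lemma bounded_operatorD:
  assumes "bounded_operator X S"
  shows "S a \<in> carrier X" "S (a + b) = S a \<oplus> S b" "S (c *\<^sub>C a) = c \<odot> S a"
    "\<exists>K. \<forall>a. vnorm X (S a) \<le> K * norm a"
  using assms by (auto simp: bounded_operator_def)

lemma bounded_operatorI:
  assumes "\<And>a. S a \<in> carrier X" "\<And>a b. S (a + b) = S a \<oplus> S b" "\<And>c a. S (c *\<^sub>C a) = c \<odot> S a"
    "\<And>a. vnorm X (S a) \<le> K * norm a"
  shows "bounded_operator X S"
  using assms by (auto simp: bounded_operator_def)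

text \<open>The infimum is itself a bound constant: for nonzero \<open>b\<close> the quotient
  \<open>vnorm X (S b) / norm b\<close> lies below every admissible \<open>K\<close>.\<close>

lemma op_norm:
  assumes "bounded_operator X S"
  shows op_norm_nonneg: "0 \<le> op_norm X S" and op_norm_bound: "vnorm X (S b) \<le> op_norm X S * norm b"
proof -
  let ?B = "{K. 0 \<le> K \<and> (\<forall>b. vnorm X (S b) \<le> K * norm b)}"
  obtain K where K: "\<And>b. vnorm X (S b) \<le> K * norm b"
    using bounded_operatorD(4)[OF assms] by auto
  \<comment> \<open>The given bound \<open>K\<close> may be negative, and \<open>max K 0\<close> is
    admissible in \<open>?B\<close>.\<close>
  have "vnorm X (S b) \<le> max K 0 * norm b" for b
    by (rule order_trans[OF K]) (simp add: mult_right_mono)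
  then have ne: "?B \<noteq> {}"
    by (auto intro!: exI[of _ "max K 0"])
  then show "0 \<le> op_norm X S"
    unfolding op_norm_def by (intro cInf_greatest) auto
  show "vnorm X (S b) \<le> op_norm X S * norm b"
  proof (cases "b = 0")
    case True
    then show ?thesis using K[of b] by simp
  next
    case False
    then have "vnorm X (S b) / norm b \<le> op_norm X S"
      unfolding op_norm_def by (intro cInf_greatest ne) (auto simp: divide_le_eq)
    then show ?thesis using False by (simp add: divide_le_eq)
  qed
qed

lemma lact_bounded':
  obtains K where "0 \<le> K" "\<And>a x. x \<in> carrier X \<Longrightarrow> vnorm X (lact X a x) \<le> K * norm a * vnorm X x"
proof -
  obtain K where K: "\<And>a x. x \<in> carrier X \<Longrightarrow> vnorm X (lact X a x) \<le> K * norm a * vnorm X x"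
    using lact_bounded by auto
  show thesis
    by (rule that[of "max K 0"], simp, rule order_trans[OF K]) (auto intro!: mult_right_mono vnorm_nonneg)
qed

lemma ract_bounded':
  obtains K where "0 \<le> K" "\<And>a x. x \<in> carrier X \<Longrightarrow> vnorm X (ract X x a) \<le> K * norm a * vnorm X x"
proof -
  obtain K where K: "\<And>a x. x \<in> carrier X \<Longrightarrow> vnorm X (ract X x a) \<le> K * norm a * vnorm X x"
    using ract_bounded by auto
  show thesis
    by (rule that[of "max K 0"], simp, rule order_trans[OF K]) (auto intro!: mult_right_mono vnorm_nonneg)
qed

lemma bounded_operator_add:
  assumes "bounded_operator X S" "bounded_operator X S'"
  shows "bounded_operator X (\<lambda>b. S b \<oplus> S' b)"
    and "op_norm X (\<lambda>b. S b \<oplus> S' b) \<le> op_norm X S + op_norm X S'"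
proof -
  note [simp] = bounded_operatorD[OF assms(1)] bounded_operatorD[OF assms(2)]
  have le: "vnorm X (S b \<oplus> S' b) \<le> (op_norm X S + op_norm X S') * norm b" for b
    using vnorm_triangle[of "S b" "S' b"]
      op_norm_bound[OF assms(1), of b] op_norm_bound[OF assms(2), of b]
    by (simp add: distrib_right)
  show "bounded_operator X (\<lambda>b. S b \<oplus> S' b)"
    by (rule bounded_operatorI[OF _ _ _ le]) (auto simp: M.a_ac smult_r_distr[simplified])
  show "op_norm X (\<lambda>b. S b \<oplus> S' b) \<le> op_norm X S + op_norm X S'"
    using op_norm_nonneg assms by (intro op_norm_le le) auto
qed

lemma bounded_operator_smult:
  assumes "bounded_operator X S"
  shows "bounded_operator X (\<lambda>b. c \<odot> S b)" and "op_norm X (\<lambda>b. c \<odot> S b) \<le> cmod c * op_norm X S"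
proof -
  note [simp] = bounded_operatorD[OF assms(1)]
  have le: "vnorm X (c \<odot> S b) \<le> (cmod c * op_norm X S) * norm b" for b
    using op_norm_bound[OF assms(1), of b] by (simp add: vnorm_smult mult.assoc mult_left_mono)
  show "bounded_operator X (\<lambda>b. c \<odot> S b)"
    by (rule bounded_operatorI[OF _ _ _ le])
      (auto simp: smult_r_distr[simplified] smult_assoc1[simplified, symmetric] mult.commute)
  show "op_norm X (\<lambda>b. c \<odot> S b) \<le> cmod c * op_norm X S"
    using op_norm_nonneg assms by (intro op_norm_le le) auto
qed

text \<open>The module constant \<open>K\<close> is passed in, so that the estimate is uniform in
  \<open>a\<close> and \<open>S\<close>, as \<open>lact_bounded\<close> for the bimodule of
  operators demands.\<close>

lemma bounded_operator_lact:
  assumes "bounded_operator X S" and "0 \<le> K"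
    "\<And>a x. x \<in> carrier X \<Longrightarrow> vnorm X (lact X a x) \<le> K * norm a * vnorm X x"
  shows "bounded_operator X (\<lambda>b. lact X a (S b))"
    and "op_norm X (\<lambda>b. lact X a (S b)) \<le> K * norm a * op_norm X S"
proof -
  note [simp] = bounded_operatorD[OF assms(1)]
  have le: "vnorm X (lact X a (S b)) \<le> (K * norm a * op_norm X S) * norm b" for b
    by (rule order_trans[OF assms(3)])
      (use op_norm_bound[OF assms(1), of b]
          assms(2) in \<open>auto simp: mult.assoc intro!: mult_left_mono\<close>)
  show "bounded_operator X (\<lambda>b. lact X a (S b))"
    by (rule bounded_operatorI[OF _ _ _ le]) (auto simp: lact_closed lact_add_right lact_smult)
  show "op_norm X (\<lambda>b. lact X a (S b)) \<le> K * norm a * op_norm X S"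
    using op_norm_nonneg assms by (intro op_norm_le le) auto
qed

text \<open>In the constant \<open>1 + K\<close>, the 1 comes from S(ab), by submultiplicativity of
  the norm, and the \<open>K\<close> from S(a) b.\<close>

lemma bounded_operator_ract:
  assumes "bounded_operator X S" and "0 \<le> K"
    "\<And>a x. x \<in> carrier X \<Longrightarrow> vnorm X (ract X x a) \<le> K * norm a * vnorm X x"
  shows "bounded_operator X (\<lambda>b. S (a * b) \<ominus> ract X (S a) b)"
    and "op_norm X (\<lambda>b. S (a * b) \<ominus> ract X (S a) b) \<le> (1 + K) * norm a * op_norm X S"
proof -
  note S = bounded_operatorD[OF assms(1)]
  note [simp] = S ract_closed
  have le: "vnorm X (S (a * b) \<ominus> ract X (S a) b) \<le> ((1 + K) * norm a * op_norm X S) * norm b" for b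
  proof -
    have "vnorm X (S (a * b) \<ominus> ract X (S a) b) \<le> vnorm X (S (a * b)) + vnorm X (ract X (S a) b)"
      using vnorm_triangle[of "S (a * b)" "\<ominus> ract X (S a) b"] by (simp add: a_minus_def vnorm_minus)
    also have "vnorm X (S (a * b)) \<le> op_norm X S * (norm a * norm b)"
      by (rule order_trans[OF op_norm_bound[OF assms(1)]])
        (intro mult_left_mono norm_mult_ineq op_norm_nonneg assms)
    also have "vnorm X (ract X (S a) b) \<le> K * norm b * (op_norm X S * norm a)"
      by (rule order_trans[OF assms(3)])
        (use op_norm_bound[OF assms(1)] assms(2) in \<open>auto intro!: mult_left_mono\<close>)
    finally show ?thesis by (simp add: algebra_simps)
  qed
  show "bounded_operator X (\<lambda>b. S (a * b) \<ominus> ract X (S a) b)"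
    by (rule bounded_operatorI[OF _ _ _ le])
      (auto simp: distrib_left add_diff_add ract_add_right mult_scaleC_right ract_scaleC smult_diff)
  show "op_norm X (\<lambda>b. S (a * b) \<ominus> ract X (S a) b) \<le> (1 + K) * norm a * op_norm X S"
    using op_norm_nonneg assms by (intro op_norm_le le) auto
qed

lemma bounded_operator_zero: "bounded_operator X (\<lambda>_. \<zero>)"
  using smult_r_null by (intro bounded_operatorI[of _ 0]) auto

end

section \<open>Banach bimodule axioms for the bounded operators\<close>

lemma abelian_group_hom_bimodule:
  fixes X :: "('b::{complex_banach_algebra, real_normed_algebra_1}, 'x) bimodule" (structure)
  assumes "banach_bimodule X"
  shows "abelian_group (hom_bimodule X)"
proof -
  interpret banach_bimodule X by fact
  show ?thesis
  proof (rule abelian_groupI)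
    fix S assume S: "S \<in> carrier (hom_bimodule X)"
    then have S': "bounded_operator X S" by simp
    show "\<exists>S'\<in>carrier (hom_bimodule X). S' \<oplus>\<^bsub>hom_bimodule X\<^esub> S = \<zero>\<^bsub>hom_bimodule X\<^esub>"
      using S bounded_operatorD(1)[OF S'] bounded_operator_smult(1)[OF S', of "-1"]
      by (intro bexI[of _ "\<lambda>b. (- 1) \<odot> S b"])
        (auto simp: minus_eq_smult[symmetric] M.l_neg)
  qed (auto simp: bounded_operator_zero bounded_operator_add(1) bounded_operatorD(1) M.a_ac
      intro!: ext)
qed

text \<open>Subtraction is defined through the abstract inverse of the group, so its pointwise form
  comes from uniqueness of inverses.\<close>

lemma hom_bimodule_minus:
  fixes X :: "('b::{complex_banach_algebra, real_normed_algebra_1}, 'x) bimodule" (structure)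
  assumes X: "banach_bimodule X" and S: "S \<in> carrier (hom_bimodule X)"
      "S' \<in> carrier (hom_bimodule X)"
  shows "S \<ominus>\<^bsub>hom_bimodule X\<^esub> S' = (\<lambda>b. S b \<ominus> S' b)"
proof -
  interpret banach_bimodule X by fact
  interpret H: abelian_group "hom_bimodule X" by (rule abelian_group_hom_bimodule[OF X])
  have S': "bounded_operator X S'" using S by simp
  have "\<ominus>\<^bsub>hom_bimodule X\<^esub> S' = (\<lambda>b. \<ominus> S' b)"
    using S bounded_operatorD(1)[OF S'] bounded_operator_smult(1)[OF S', of "-1"]
    by (intro H.minus_equality) (auto simp: M.l_neg simp flip: minus_eq_smult)
  then show ?thesis by (simp add: a_minus_def)
qed

lemma unital_banach_bimodule_hom:
  fixes X :: "('b::{complex_banach_algebra, real_normed_algebra_1}, 'x) bimodule" (structure)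
  assumes X: "unital_banach_bimodule X"
  shows "unital_banach_bimodule (hom_bimodule X)"
proof -
  interpret unital_banach_bimodule X by fact
  have ag: "abelian_group (hom_bimodule X)"
    by (rule abelian_group_hom_bimodule) unfold_locales
  note [simp] = bounded_operatorD(1)
  have mod: "Module.module complex_field (hom_bimodule X)"
    by (rule moduleI[OF cring_complex_field ag])
      (auto simp: bounded_operator_smult(1) smult_l_distr[simplified] smult_r_distr[simplified]
        smult_assoc1[simplified] smult_one[simplified] intro!: ext)
  have minus: "S \<ominus>\<^bsub>hom_bimodule X\<^esub> S' = (\<lambda>b. S b \<ominus> S' b)"
    if "S \<in> carrier (hom_bimodule X)" "S' \<in> carrier (hom_bimodule X)" for S S'
    using that by (intro hom_bimodule_minus) unfold_locales
  obtain Kl where Kl: "0 \<le> Kl"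
      "\<And>a x. x \<in> carrier X \<Longrightarrow> vnorm X (lact X a x) \<le> Kl * norm a * vnorm X x"
    using lact_bounded' by blast
  obtain Kr where Kr: "0 \<le> Kr"
      "\<And>a x. x \<in> carrier X \<Longrightarrow> vnorm X (ract X x a) \<le> Kr * norm a * vnorm X x"
    using ract_bounded' by blast
  have "banach_bimodule (hom_bimodule X)"
  \<comment> \<open>The case numbers follow the order of the locale axioms: 1 to 4 are the norm and
    completeness, 5 to 11 the left action, 12 to 18 the right action, 19 their
    compatibility.\<close>
  proof (intro banach_bimodule.intro mod banach_bimodule_axioms.intro, goal_cases)
    case (1 S)
    then have S: "bounded_operator X S" by simp
    show ?case
    proof
      assume "vnorm (hom_bimodule X) S = 0"
      then have "vnorm X (S b) = 0" for b
        using op_norm_bound[OF S, of b] vnorm_nonneg[of "S b"] S by simp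
      then show "S = \<zero>\<^bsub>hom_bimodule X\<^esub>"
        using vnorm_eq_0 S by auto
    next
      assume "S = \<zero>\<^bsub>hom_bimodule X\<^esub>"
      then show "vnorm (hom_bimodule X) S = 0"
        using op_norm_le[of 0 X S] op_norm_nonneg[OF S] by simp
    qed
  next
    case (2 S S')
    then show ?case using bounded_operator_add(2) by simp
  next
    case (3 S c)
    then have S: "bounded_operator X S" by simp
    show ?case
    proof (cases "c = 0")
      case True
      then show ?thesis
        using op_norm_le[of 0 X "\<lambda>b. 0 \<odot> S b"] bounded_operator_smult[OF S, of 0]
          op_norm_nonneg[of "\<lambda>b. 0 \<odot> S b"] by simp
    next
      case False
      \<comment> \<open>The estimate for scalar multiples gives one inequality for \<open>c\<close>;
        applied to \<open>1 / c\<close> it gives the reverse one.\<close>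
      have "op_norm X (\<lambda>b. (1 / c) \<odot> (c \<odot> S b)) \<le> cmod (1 / c) * op_norm X (\<lambda>b. c \<odot> S b)"
        by (intro bounded_operator_smult S)
      moreover have "(\<lambda>b. (1 / c) \<odot> (c \<odot> S b)) = S"
        using False S by (auto simp: smult_assoc1[simplified, symmetric] smult_one[simplified])
      ultimately have "cmod c * op_norm X S \<le> op_norm X (\<lambda>b. c \<odot> S b)"
        using False by (simp add: norm_divide field_simps)
      then show ?thesis
        using bounded_operator_smult(2)[OF S, of c] by simp
    qed
  next
    case (4 s)
    then have s: "bounded_operator X (s n)" "s n 1 = \<zero>" for n by auto
    have s_diff: "bounded_operator X (\<lambda>b. s m b \<ominus> s n b)" for m n
      using bounded_operator_add(1)[OF s(1)[of m]
      bounded_operator_smult(1)[OF s(1)[of n], of "- 1"]] s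
      by (simp add: diff_eq_smult)
    have Cauchy: "\<exists>N. \<forall>m\<ge>N. \<forall>n\<ge>N. op_norm X (\<lambda>b. s m b \<ominus> s n b) < e" if "e > 0" for e
      using 4 that by (simp add: minus)
    have bd: "vnorm X (s m b \<ominus> s n b) \<le> e * norm b"
      if "op_norm X (\<lambda>b. s m b \<ominus> s n b) < e" for m n b e
      by (rule order_trans[OF op_norm_bound[OF s_diff]]) (use that in \<open>simp add: mult_right_mono\<close>)
    have "\<exists>x. tends (\<lambda>n. s n b) x" for b
    proof -
      have "\<exists>N. \<forall>m\<ge>N. \<forall>n\<ge>N. vnorm X (s m b \<ominus> s n b) < e" if "e > 0" for e
      proof -
        \<comment> \<open>Adding 1 avoids dividing by zero when \<open>b = 0\<close>.\<close>
        have "norm b + 1 > 0" by (simp add: add_nonneg_pos)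
        with that obtain N where N: "\<forall>m\<ge>N. \<forall>n\<ge>N. op_norm X (\<lambda>b. s m b \<ominus> s n b) < e / (norm b + 1)"
          using Cauchy[of "e / (norm b + 1)"] by auto
        have "e / (norm b + 1) * norm b < e"
          using that \<open>norm b + 1 > 0\<close> by (simp add: field_simps)
        with N bd show ?thesis by (meson le_less_trans)
      qed
      then obtain x where "x \<in> carrier X" "(\<lambda>n. vnorm X (s n b \<ominus> x)) \<longlonglongrightarrow> 0"
        using complete[of "\<lambda>n. s n b"] s by auto
      then show ?thesis using s by (auto simp: tends_def)
    qed
    then obtain L where L: "\<And>b. tends (\<lambda>n. s n b) (L b)" by metis
    have L_cl: "L b \<in> carrier X" for b using L by (simp add: tends_def)
    have lim: "vnorm X (s n b \<ominus> L b) \<le> e * norm b"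
      if N: "\<forall>m\<ge>N. \<forall>n\<ge>N. op_norm X (\<lambda>b. s m b \<ominus> s n b) < e" and n: "n \<ge> N" for N n e b
    proof -
      have "(\<lambda>m. e * norm b + vnorm X (s m b \<ominus> L b)) \<longlonglongrightarrow> e * norm b + 0"
        using L[of b] by (intro tendsto_intros) (auto simp: tends_def)
      \<comment> \<open>Letting \<open>m\<close> tend to infinity removes the last summand. Since
        \<open>N\<close> does not depend on \<open>b\<close>, the resulting estimate controls the
        operator norm of the difference.\<close>
      moreover have "vnorm X (s n b \<ominus> L b) \<le> e * norm b + vnorm X (s m b \<ominus> L b)" if "m \<ge> N" for m
        using vnorm_diff_triangle[of "s n b" "s m b" "L b"] bd[of n m e b] N n that s L_cl by force
      ultimately have "vnorm X (s n b \<ominus> L b) \<le> e * norm b + 0"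
        by (intro LIMSEQ_le_const) auto
      then show ?thesis by simp
    qed
    obtain N where N: "\<forall>m\<ge>N. \<forall>n\<ge>N. op_norm X (\<lambda>b. s m b \<ominus> s n b) < 1"
      using Cauchy[of 1] by auto
    have "bounded_operator X L"
    proof (rule bounded_operatorI)
      show "L a \<in> carrier X" for a by (rule L_cl)
      show "L (a + b) = L a \<oplus> L b" for a b
        using tends_add[OF L L, of a b] L[of "a + b"] s
        by (intro tends_unique[OF L]) (simp add: bounded_operatorD)
      show "L (c *\<^sub>C a) = c \<odot> L a" for c a
        using tends_smult[OF L, of c a] s
        by (intro tends_unique[OF L]) (simp add: bounded_operatorD)
      \<comment> \<open>The limit stays within distance 1 of the single operator \<open>s N\<close>,
        which supplies its bound.\<close>
      show "vnorm X (L a) \<le> (1 + op_norm X (s N)) * norm a" for a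
      proof -
        have "L a = (L a \<ominus> s N a) \<oplus> s N a"
          using s L_cl by (simp add: a_minus_def M.a_assoc M.l_neg)
        then have "vnorm X (L a) \<le> vnorm X (L a \<ominus> s N a) + vnorm X (s N a)"
          using vnorm_triangle[of "L a \<ominus> s N a" "s N a"] s L_cl by simp
        then show ?thesis
          using lim[OF N order_refl, of a] op_norm_bound[OF s(1)[of N], of a] s L_cl
          by (simp add: vnorm_minus_commute[of "L a"] distrib_right)
      qed
    qed
    moreover have "L 1 = \<zero>"
      using L[of 1] tends_unique[of "\<lambda>_. \<zero>" "L 1" \<zero>] s by (simp add: tends_def diff_self)
    ultimately have L_in: "L \<in> carrier (hom_bimodule X)" by simp
    have L_diff: "bounded_operator X (\<lambda>b. s n b \<ominus> L b)" for n
      using bounded_operator_add(1)[OF s(1)[of n] bounded_operator_smult(1)[of L "- 1"]] s L_in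
      by (simp add: diff_eq_smult)
    have "(\<lambda>n. op_norm X (\<lambda>b. s n b \<ominus> L b)) \<longlonglongrightarrow> 0"
    proof (rule LIMSEQ_I)
      fix e :: real assume "e > 0"
      \<comment> \<open>The limit estimate is not strict; halving \<open>e\<close> restores
        strictness.\<close>
      then obtain N where N: "\<forall>m\<ge>N. \<forall>n\<ge>N. op_norm X (\<lambda>b. s m b \<ominus> s n b) < e / 2"
        using Cauchy[of "e / 2"] by auto
      have "op_norm X (\<lambda>b. s n b \<ominus> L b) \<le> e / 2" if "n \<ge> N" for n
        using lim[OF N that] \<open>e > 0\<close> by (intro op_norm_le) auto
      then show "\<exists>N. \<forall>n\<ge>N. norm (op_norm X (\<lambda>b. s n b \<ominus> L b) - 0) < e"
        using op_norm_nonneg[OF L_diff] \<open>e > 0\<close> by (intro exI[of _ N]) force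
    qed
    then show ?case
      using L_in 4 by (intro bexI[of _ L]) (auto simp: minus)
  next
    case (5 S a)
    then show ?case using bounded_operator_lact(1)[OF _ Kl] by simp
  next
    case (11)
    then show ?case using bounded_operator_lact(2)[OF _ Kl] by auto
  next
    case (12 S a)
    then show ?case using bounded_operator_ract(1)[OF _ Kr] ract_one by (simp add: diff_self)
  next
    case (13 S a b)
    then show ?case
      by (auto simp: distrib_right bounded_operatorD ract_add_left add_diff_add ract_closed)
  next
    case (14 S c a)
    then show ?case
      by (auto simp: mult_scaleC_left bounded_operatorD ract_smult smult_diff ract_closed)
  next
    case (15 S S' a)
    then show ?case
      by (auto simp: ract_add_left add_diff_add ract_closed)
  next
    case (16 S c a)
    then show ?case by (auto simp: ract_smult smult_diff ract_closed)
  next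
    case (17 S a b)
    \<comment> \<open>Acting by \<open>a\<close> and then by \<open>b\<close> produces S(a) b c
      twice, with opposite signs; here \<open>y\<close> is that term.\<close>
    have *: "x \<ominus> z = (x \<ominus> y) \<ominus> (z \<ominus> y)" if "x \<in> carrier X" "y \<in> carrier X" "z \<in> carrier X" for x y z
      using that by (simp add: a_minus_def M.minus_add M.a_ac M.r_neg1 M.r_neg2)
    show ?case
    proof
      fix c
      show "ract (hom_bimodule X) S (a * b) c
          = ract (hom_bimodule X) (ract (hom_bimodule X) S a) b c"
        using 17 *[of "S (a * (b * c))" "ract X (S a) (b * c)" "ract X (S (a * b)) c"]
        by (simp add: mult.assoc ract_closed ract_mult ract_diff[symmetric])
    qed
  next
    case 18
    then show ?case using bounded_operator_ract(2)[OF _ Kr] by auto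
  next
    case (19 S a b)
    then show ?case by (auto simp: lact_ract lact_diff[symmetric] ract_closed)
  qed (auto simp: lact_add_left lact_scaleC lact_add_right lact_smult lact_mult)
  then show ?thesis
    using lact_one by (intro unital_banach_bimodule.intro unital_banach_bimodule_axioms.intro)
      (auto simp: lact_one a_minus_def)
qed

section \<open>Functoriality of the coboundary\<close>

text \<open>Serves both for module maps and for evaluating a sum of operators at a point. Zero goes
  to zero by cancellation.\<close>

lemma additive_finsum:
  assumes "abelian_group G" "abelian_group H" "finite A"
    and h: "\<And>x. x \<in> carrier G \<Longrightarrow> h x \<in> carrier H"
      "\<And>x y. \<lbrakk>x \<in> carrier G; y \<in> carrier G\<rbrakk> \<Longrightarrow> h (x \<oplus>\<^bsub>G\<^esub> y) = h x \<oplus>\<^bsub>H\<^esub> h y"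
    and f: "\<And>i. i \<in> A \<Longrightarrow> f i \<in> carrier G"
  shows "h (\<Oplus>\<^bsub>G\<^esub>i\<in>A. f i) = (\<Oplus>\<^bsub>H\<^esub>i\<in>A. h (f i))"
proof -
  interpret G: abelian_group G by fact
  interpret H: abelian_group H by fact
  have "h \<zero>\<^bsub>G\<^esub> \<oplus>\<^bsub>H\<^esub> h \<zero>\<^bsub>G\<^esub> = h \<zero>\<^bsub>G\<^esub>"
    using h(2)[of "\<zero>\<^bsub>G\<^esub>" "\<zero>\<^bsub>G\<^esub>"] by simp
  then have h0: "h \<zero>\<^bsub>G\<^esub> = \<zero>\<^bsub>H\<^esub>"
    using h(1)[of "\<zero>\<^bsub>G\<^esub>"] H.add.l_cancel_one by simp
  show ?thesis
    using \<open>finite A\<close> f by (induction rule: finite_induct) (auto simp: h0 h Pi_def G.finsum_closed)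
qed

lemma length_merge_args [simp]: "\<lbrakk>1 \<le> j; j < length as\<rbrakk> \<Longrightarrow> length (merge_args j as) = length as - 1"
  by (simp add: merge_args_def)

lemma map_merge_args:
  "\<lbrakk>\<And>a b. h (a * b) = h a * h b; 1 \<le> j; j < length as\<rbrakk>
    \<Longrightarrow> merge_args j (map h as) = map h (merge_args j as)"
  by (simp add: merge_args_def take_map drop_map)

text \<open>Together with \<open>merge_args_snoc\<close>, this separates the merges inside
  \<open>as\<close> from the one that multiplies into the appended argument.\<close>

lemma merge_args_append: "\<lbrakk>1 \<le> j; j < length as\<rbrakk> \<Longrightarrow> merge_args j (as @ bs) = merge_args j as @ bs"
  by (simp add: merge_args_def nth_append less_imp_diff_less)

lemma merge_args_snoc: "length as = Suc n
    \<Longrightarrow> merge_args (Suc n) (as @ [b]) = take n as @ [as ! n * b]"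
  by (simp add: merge_args_def nth_append)

text \<open>Every term of the coboundary is built from operations that \<open>h\<close> and
  \<open>\<phi>\<close> respect. Used with \<open>\<phi>\<close> the identity and \<open>h\<close>
  an injective recoding of the values, and with \<open>h\<close> the identity and
  \<open>\<phi>\<close> the embedding of the algebra into its unitization.\<close>

lemma coboundary_map:
  assumes X: "banach_bimodule X" and Z: "banach_bimodule Z"
    and h: "\<And>x. x \<in> carrier X \<Longrightarrow> h x \<in> carrier Z"
      "\<And>x y. \<lbrakk>x \<in> carrier X; y \<in> carrier X\<rbrakk> \<Longrightarrow> h (x \<oplus>\<^bsub>X\<^esub> y) = h x \<oplus>\<^bsub>Z\<^esub> h y"
      "\<And>c x. x \<in> carrier X \<Longrightarrow> h (c \<odot>\<^bsub>X\<^esub> x) = c \<odot>\<^bsub>Z\<^esub> h x"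
      "\<And>a x. x \<in> carrier X \<Longrightarrow> h (lact X a x) = lact Z (\<phi> a) (h x)"
      "\<And>a x. x \<in> carrier X \<Longrightarrow> h (ract X x a) = ract Z (h x) (\<phi> a)"
    and \<phi>: "\<And>a b. \<phi> (a * b) = \<phi> a * \<phi> b"
    and T: "\<And>as. length as = n \<Longrightarrow> T as \<in> carrier X"
      "\<And>as. length as = n \<Longrightarrow> S (map \<phi> as) = h (T as)"
    and as: "length as = n + 1"
  shows "coboundary n Z S (map \<phi> as) = h (coboundary n X T as)"
proof -
  interpret X: banach_bimodule X by fact
  interpret Z: banach_bimodule Z by fact
  have [simp]: "T (drop (Suc 0) as) \<in> carrier X" "T (take n as) \<in> carrier X"
    using as by (auto intro!: T)
  have [simp]: "T (merge_args j as) \<in> carrier X" if "j \<in> {Suc 0..n}" for j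
    using as that by (auto intro!: T)
  have "h (\<Oplus>\<^bsub>X\<^esub>j\<in>{1..n}. (- 1) ^ j \<odot>\<^bsub>X\<^esub> T (merge_args j as))
      = (\<Oplus>\<^bsub>Z\<^esub>j\<in>{1..n}. h ((- 1) ^ j \<odot>\<^bsub>X\<^esub> T (merge_args j as)))"
    by (rule additive_finsum) (auto simp: h X.M.abelian_group_axioms Z.M.abelian_group_axioms)
  also have "\<dots> = (\<Oplus>\<^bsub>Z\<^esub>j\<in>{1..n}. (- 1) ^ j \<odot>\<^bsub>Z\<^esub> S (merge_args j (map \<phi> as)))"
    using as by (intro Z.M.finsum_cong') (auto simp: h map_merge_args \<phi> T)
  finally have *: "h (\<Oplus>\<^bsub>X\<^esub>j\<in>{1..n}. (- 1) ^ j \<odot>\<^bsub>X\<^esub> T (merge_args j as)) = \<dots>" .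
  have "h (coboundary n X T as) = lact Z (\<phi> (as ! 0)) (h (T (drop 1 as)))
    \<oplus>\<^bsub>Z\<^esub> h (\<Oplus>\<^bsub>X\<^esub>j\<in>{1..n}. (- 1) ^ j \<odot>\<^bsub>X\<^esub> T (merge_args j as))
    \<oplus>\<^bsub>Z\<^esub> (- 1) ^ (n + 1) \<odot>\<^bsub>Z\<^esub> ract Z (h (T (take n as))) (\<phi> (as ! n))"
    using as by (simp add: coboundary_def h X.lact_closed X.ract_closed X.M.finsum_closed Pi_def)
  also have "\<dots> = coboundary n Z S (map \<phi> as)"
    unfolding * coboundary_def using as T(2)[of "drop 1 as"] T(2)[of "take n as"]
    by (simp add: take_map drop_map)
  finally show ?thesis ..
qed

section \<open>Normalised hyperlocal multilinear maps\<close>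

text \<open>The multilinear analogue of \<open>hyperlocal\<close>, to which the chain condition
  reduces for \<open>n = 1\<close>. Boundedness is included because conditions (i) and (ii) concern
  bounded operators, and vanishing at 1 because the elements of \<open>hom_bimodule X\<close> are
  normalised.\<close>

definition normalised_hyperlocal ::
    "nat \<Rightarrow> ('b::{complex_banach_algebra, real_normed_algebra_1}, 'x) bimodule \<Rightarrow> ('b list \<Rightarrow> 'x) \<Rightarrow> bool"
  where "normalised_hyperlocal n X T \<longleftrightarrow> bounded_n_linear n X T \<and>
    (\<forall>as. length as = n \<and> 1 \<in> set as \<longrightarrow> T as = \<zero>\<^bsub>X\<^esub>) \<and>
    (\<forall>a as b. length as = n \<and> successively (\<lambda>x y. x * y = 0) (a # as @ [b])
      \<longrightarrow> lact X a (ract X (T as) b) = \<zero>\<^bsub>X\<^esub>)"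

section \<open>Recoding a whole bimodule along an injection of its carrier\<close>

lemma (in unital_banach_bimodule) unital_banach_bimodule_transported:
  assumes "inj_on f (carrier X)"
  shows "unital_banach_bimodule (transported (carrier X) f)"
proof -
  have "banach_bimodule (transported (carrier X) f)"
    by (rule banach_bimodule_transported) (use assms in \<open>auto
        simp: lact_closed ract_closed tends_def\<close>)
  then show ?thesis
    using assms
    by (intro unital_banach_bimodule.intro unital_banach_bimodule_axioms.intro)
      (auto simp: lact_one ract_one)
qed

lemma (in unital_banach_bimodule) normalised_hyperlocal_transported:
  assumes inj: "inj_on f (carrier X)" and T: "normalised_hyperlocal n X T"
  shows "normalised_hyperlocal n (transported (carrier X) f) (f \<circ> T)"
proof -
  have "T as \<in> carrier X" if "length as = n" for as
    using T that by (auto simp: normalised_hyperlocal_def bounded_n_linear_def n_linear_def)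
  then show ?thesis
    using T inj
    by (auto simp: normalised_hyperlocal_def bounded_n_linear_def n_linear_def ract_closed
        lact_closed)
qed

text \<open>By naturality \<open>f\<close> maps the coboundary of \<open>T\<close> to that of
  \<open>f \<circ> T\<close>, which is the image of zero; injectivity then gives the identity for
  \<open>T\<close> itself.\<close>

lemma (in unital_banach_bimodule) cocycle_transportedD:
  assumes inj: "inj_on f (carrier X)" and T: "n_linear n X T"
    and coc: "cocycle n (transported (carrier X) f) (f \<circ> T)"
  shows "cocycle n X T"
proof -
  interpret Z: unital_banach_bimodule "transported (carrier X) f"
    by (rule unital_banach_bimodule_transported) fact
  have T_cl: "T as \<in> carrier X" if "length as = n" for as
    using T that by (auto simp: n_linear_def)
  show ?thesis
    unfolding cocycle_def
  proof (intro conjI T allI impI)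
    fix as :: "'b list" assume as: "length as = n + 1"
    have cl: "coboundary n X T as \<in> carrier X"
      using as unfolding coboundary_def
      by (auto intro!: M.a_closed lact_closed ract_closed smult_closed' M.finsum_closed T_cl)
    have "coboundary n (transported (carrier X) f) (f \<circ> T) (map id as) = f (coboundary n X T as)"
      by (rule coboundary_map) (use inj T_cl as in \<open>auto
          simp: Z.banach_bimodule_axioms banach_bimodule_axioms\<close>)
    then have "f (coboundary n X T as) = f \<zero>"
      using coc as by (simp add: cocycle_def)
    then show "coboundary n X T as = \<zero>"
      using inj cl by (auto dest: inj_onD)
  qed
qed


context banach_bimodule
begin

lemma diff_eq_zeroD:
  assumes "x \<in> carrier X" "y \<in> carrier X" "x \<ominus> y = \<zero>"
  shows "x = y"
  using assms M.minus_equality[of x "\<ominus> y"] by (simp add: a_minus_def)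

lemma n_linear_closed: "n_linear n X T \<Longrightarrow> length as = n \<Longrightarrow> T as \<in> carrier X"
  by (simp add: n_linear_def)

lemma bounded_operator_comp_mult:
  assumes S: "bounded_operator X S"
  shows "bounded_operator X (\<lambda>b. S (c * b))"
proof (rule bounded_operatorI)
  show "vnorm X (S (c * b)) \<le> op_norm X S * norm c * norm b" for b
    by (rule order_trans[OF op_norm_bound[OF S]])
      (simp add: mult.assoc mult_left_mono norm_mult_ineq op_norm_nonneg[OF S])
qed (simp_all add: bounded_operatorD[OF S] distrib_left mult_scaleC_right)

lemma bounded_operator_snoc:
  assumes T: "bounded_n_linear (Suc n) X T" and as: "length as = n"
  shows "bounded_operator X (\<lambda>b. T (as @ [b]))"
proof -
  obtain K where K: "\<And>as. length as = Suc n \<Longrightarrow> vnorm X (T as) \<le> K * (\<Prod>a\<leftarrow>as. norm a)"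
    and lin: "n_linear (Suc n) X T"
    using T by (auto simp: bounded_n_linear_def)
  show ?thesis
  proof (rule bounded_operatorI)
    show "T (as @ [b]) \<in> carrier X" for b
      using lin as by (simp add: n_linear_closed)
    \<comment> \<open>\<open>n_linear\<close> is phrased with list updates; the placeholder 0 at
      position \<open>n\<close> is overwritten and makes the appended argument such an
      update.\<close>
    have *: "T ((as @ [0])[n := a + b]) = T ((as @ [0])[n := a]) \<oplus> T ((as @ [0])[n := b])"
      "T ((as @ [0])[n := c *\<^sub>C a]) = c \<odot> T ((as @ [0])[n := a])" for a b c
      using lin as unfolding n_linear_def by simp_all
    then show "T (as @ [a + b]) = T (as @ [a]) \<oplus> T (as @ [b])"
      "T (as @ [c *\<^sub>C a]) = c \<odot> T (as @ [a])" for a b c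
      by (simp_all flip: as)
    show "vnorm X (T (as @ [b])) \<le> (K * (\<Prod>a\<leftarrow>as. norm a)) * norm b" for b
      using K[of "as @ [b]"] as by (simp add: mult.assoc)
  qed
qed

end

section \<open>One argument, and the reduction by one argument\<close>

lemma (in unital_banach_bimodule) normalised_hyperlocal_imp_cocycle_1:
  assumes cond: "\<And>D. \<lbrakk>bounded_operator X D; hyperlocal X D\<rbrakk> \<Longrightarrow>
        \<forall>a b c. D (a * c * b) \<ominus> lact X a (D (c * b)) \<ominus> ract X (D (a * c)) b
            \<oplus> lact X a (ract X (D c) b) = \<zero>"
    and T: "normalised_hyperlocal 1 X T"
  shows "cocycle 1 X T"
  unfolding cocycle_def
proof (intro conjI allI impI)
  show lin: "n_linear 1 X T"
    using T by (simp add: normalised_hyperlocal_def bounded_n_linear_def)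
  define D where "D b = T [b]" for b
  have cl: "D b \<in> carrier X" for b
    using lin by (simp add: D_def n_linear_closed)
  have D: "bounded_operator X D"
    using bounded_operator_snoc[of 0 T "[]"] T
    by (simp add: D_def [abs_def] normalised_hyperlocal_def)
  have hyp: "lact X a (ract X (T as) b) = \<zero>"
      if "length as = 1" "successively (\<lambda>x y. x * y = 0) (a # as @ [b])" for a as b
    using T that by (simp add: normalised_hyperlocal_def)
  have "hyperlocal X D"
    unfolding hyperlocal_def using hyp[of "[_]"] by (simp add: D_def)
  moreover have D1: "D 1 = \<zero>"
    using T by (simp add: D_def normalised_hyperlocal_def)
  \<comment> \<open>The instance c = 1 of the identity: its fourth term a D(1) b vanishes.\<close>
  ultimately have "D (a * b) \<ominus> lact X a (D b) \<ominus> ract X (D a) b = \<zero>" for a b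
    using cond[OF D, THEN spec[of _ a], THEN spec[of _ b], THEN spec[of _ 1]]
    cl lact_closed ract_closed by simp
  then have "D (a * b) \<ominus> lact X a (D b) = ract X (D a) b" for a b
    by (rule diff_eq_zeroD[rotated 2]) (simp_all add: cl lact_closed ract_closed)
  then have "lact X a (D b) \<oplus> ract X (D a) b = lact X a (D b) \<oplus> (D (a * b) \<ominus> lact X a (D b))"
      for a b
    by simp
  then have eq: "D (a * b) = lact X a (D b) \<oplus> ract X (D a) b" for a b
    using cl lact_closed ract_closed by (simp add: a_minus_def M.a_ac M.r_neg)
  fix as :: "'b list" assume "length as = 1 + 1"
  then obtain a b where as: "as = [a, b]"
    by (auto simp: numeral_2_eq_2 length_Suc_conv)
  have "coboundary 1 X T as = lact X a (D b) \<oplus> (\<ominus> D (a * b)) \<oplus> ract X (D a) b"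
    using cl[of "a * b"] cl[of a] ract_closed
    by (simp add: coboundary_def as merge_args_def D_def[symmetric] minus_eq_smult smult_one[simplified])
  also have "\<dots> = \<zero>"
    using cl lact_closed ract_closed by (simp add: eq M.minus_add M.a_ac M.r_neg1 M.r_neg2 M.r_neg)
  finally show "coboundary 1 X T as = \<zero>" .
qed

text \<open>In the chain condition for the new map, the right action by the final entry
  \<open>c\<close> produces a T(as, c b) - a T(as, c) b. This is the left multiplier defect of b
  \<mapsto> a T(as, c b) at 1, which condition (i) annihilates.\<close>

lemma (in unital_banach_bimodule) normalised_hyperlocal_snoc:
  assumes cond: "\<And>D. bounded_operator X D \<Longrightarrow>
        left_multiplier X D \<longleftrightarrow> (\<forall>a b. b * a = 0 \<longrightarrow> ract X (D b) a = \<zero>)"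
    and T: "normalised_hyperlocal (Suc n) X T"
  shows "normalised_hyperlocal n (hom_bimodule X) (\<lambda>as b. T (as @ [b]))"
proof -
  have bdd: "bounded_n_linear (Suc n) X T" and lin: "n_linear (Suc n) X T"
    and one: "\<And>as. length as = Suc n \<Longrightarrow> 1 \<in> set as \<Longrightarrow> T as = \<zero>"
    and hyp: "\<And>a as b. length as = Suc n \<Longrightarrow> successively (\<lambda>x y. x * y = 0) (a # as @ [b])
      \<Longrightarrow> lact X a (ract X (T as) b) = \<zero>"
    using T by (simp_all add: normalised_hyperlocal_def bounded_n_linear_def)
  note op = bounded_operator_snoc[OF bdd]
  have cl: "T (as @ [b]) \<in> carrier X" if "length as = n" for as b
    using lin that by (simp add: n_linear_closed)
  obtain K where K: "\<And>as. length as = Suc n \<Longrightarrow> vnorm X (T as) \<le> K * (\<Prod>a\<leftarrow>as. norm a)"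
    using bdd by (auto simp: bounded_n_linear_def)
  have prod_nonneg: "0 \<le> (\<Prod>a\<leftarrow>as. norm a)" for as :: "'b list"
    by (induction as) auto
  have "op_norm X (\<lambda>b. T (as @ [b])) \<le> max K 0 * (\<Prod>a\<leftarrow>as. norm a)" if "length as = n" for as
  proof (rule op_norm_le)
    fix b
    have "vnorm X (T (as @ [b])) \<le> K * ((\<Prod>a\<leftarrow>as. norm a) * norm b)"
      using K[of "as @ [b]"] that by simp
    also have "\<dots> \<le> max K 0 * ((\<Prod>a\<leftarrow>as. norm a) * norm b)"
      by (intro mult_right_mono mult_nonneg_nonneg prod_nonneg) auto
    finally show "vnorm X (T (as @ [b])) \<le> max K 0 * (\<Prod>a\<leftarrow>as. norm a) * norm b"
      by (simp add: mult.assoc)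
  qed (simp add: prod_nonneg)
  moreover have "n_linear n (hom_bimodule X) (\<lambda>as b. T (as @ [b]))"
    unfolding n_linear_def
  proof (intro conjI allI impI ext; (elim conjE)?)
    fix as :: "'b list" and i and a b d :: 'b and c assume as: "length as = n" "i < n"
    have *: "T ((as @ [d])[i := a + b]) = T ((as @ [d])[i := a]) \<oplus> T ((as @ [d])[i := b])"
      "T ((as @ [d])[i := c *\<^sub>C a]) = c \<odot> T ((as @ [d])[i := a])"
      using lin as unfolding n_linear_def by simp_all
    show "T (as[i := a + b] @ [d])
        = ((\<lambda>d. T (as[i := a] @ [d])) \<oplus>\<^bsub>hom_bimodule X\<^esub> (\<lambda>d. T (as[i := b] @ [d]))) d"
      "T (as[i := c *\<^sub>C a] @ [d]) = (c \<odot>\<^bsub>hom_bimodule X\<^esub> (\<lambda>d. T (as[i := a] @ [d]))) d"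
      using as * by (simp_all add: list_update_append1)
  \<comment> \<open>Membership in \<open>hom_bimodule X\<close> uses the normalisation of
    \<open>T\<close> in its last argument; the other arguments pass it on to the new map.\<close>
  qed (simp add: op one)
  moreover have "lact X a (T (as @ [c * b]) \<ominus> ract X (T (as @ [c])) b) = \<zero>"
    if as: "length as = n" and succ: "successively (\<lambda>x y. x * y = 0) (a # as @ [c])" for a as b c
  proof -
    define D where "D b = lact X a (T (as @ [c * b]))" for b
    obtain K where K: "0 \<le> K" "\<And>a x. x \<in> carrier X \<Longrightarrow> vnorm X (lact X a x) \<le> K * norm a * vnorm X x"
      using lact_bounded' by blast
    have D: "bounded_operator X D"
      unfolding D_def by (intro bounded_operator_lact[OF _ K] bounded_operator_comp_mult op as)
    \<comment> \<open>If b d = 0, then replacing \<open>c\<close> by \<open>c * b\<close> and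
      appending \<open>d\<close> leaves a zero product chain, by associativity.
      \<open>last (a # as)\<close> also covers empty \<open>as\<close>.\<close>
    have "ract X (D b) d = \<zero>" if "b * d = 0" for b d
    proof -
      have "last (a # as) * c = 0" "successively (\<lambda>x y. x * y = 0) (a # as)"
        using succ successively_append_iff[of _ "a # as" "[c]"] by auto
      then have "last (a # as) * (c * b) = 0" "c * b * d = 0"
        using that by (metis mult.assoc mult_zero_left, simp add: mult.assoc)
      then have "successively (\<lambda>x y. x * y = 0) ((a # as) @ [c * b, d])"
        using \<open>successively _ (a # as)\<close> by (subst successively_append_iff) auto
      then show ?thesis
        using hyp[of "as @ [c * b]" a d] as cl by (simp add: D_def lact_ract)
    qed
    then have "left_multiplier X D"
      using cond[OF D] by blast
    \<comment> \<open>The multiplier identity at 1 is the required equation, because D(1) = a T(as,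
      c).\<close>
    then have "D (1 * b) = ract X (D 1) b"
      unfolding left_multiplier_def by blast
    then have "lact X a (T (as @ [c * b])) = lact X a (ract X (T (as @ [c])) b)"
      using cl[OF as] by (simp add: D_def lact_ract)
    then show ?thesis
      using cl[OF as] by (simp add: lact_diff[symmetric] lact_closed ract_closed diff_self)
  qed
  ultimately show ?thesis
    unfolding normalised_hyperlocal_def bounded_n_linear_def using one by auto
qed

text \<open>The coboundary of the operator-valued map, evaluated at \<open>b\<close>, is the
  coboundary of \<open>T\<close> at \<open>as @ [b]\<close>: the two parts of its right action term
  are the last merge and the outer right multiplication.\<close>

lemma (in unital_banach_bimodule) cocycle_snocD:
  assumes T: "n_linear (Suc n) X T"
    and op: "\<And>as. length as = n \<Longrightarrow> (\<lambda>b. T (as @ [b])) \<in> carrier (hom_bimodule X)"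
    and coc: "cocycle n (hom_bimodule X) (\<lambda>as b. T (as @ [b]))"
  shows "cocycle (Suc n) X T"
  unfolding cocycle_def
proof (intro conjI T allI impI)
  let ?H = "hom_bimodule X"
  interpret H: unital_banach_bimodule ?H
    by (rule unital_banach_bimodule_hom) unfold_locales
  have cl [simp]: "T as \<in> carrier X" if "length as = Suc n" for as
    using T that by (simp add: n_linear_closed)
  fix cs :: "'b list" assume "length cs = Suc n + 1"
  then obtain as b where cs: "cs = as @ [b]" and as: "length as = Suc n"
    by (cases cs rule: rev_cases) auto
  \<comment> \<open>The common sign of the right action term for \<open>n\<close> arguments and of
    merge \<open>n + 1\<close> for \<open>T\<close>; the outer right term of \<open>T\<close> has
    sign \<open>- c\<close>.\<close>
  define c :: complex where "c = (- 1) ^ (n + 1)"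
  \<comment> \<open>The merges inside \<open>as\<close>, shared by both coboundaries.\<close>
  define s where "s = (\<Oplus>j\<in>{1..n}. (- 1) ^ j \<odot> T (merge_args j as @ [b]))"
  have s: "s \<in> carrier X"
    unfolding s_def using as by (intro M.finsum_closed) auto
  have "(\<Oplus>\<^bsub>?H\<^esub>j\<in>{1..n}. (- 1) ^ j \<odot>\<^bsub>?H\<^esub> (\<lambda>b. T (merge_args j as @ [b]))) b = s"
    unfolding s_def using as op smult_r_null
    by (subst additive_finsum[where h = "\<lambda>S. S b" and H = X])
      (auto simp: H.M.abelian_group_axioms M.abelian_group_axioms bounded_operatorD
          bounded_operator_smult)
  then have "coboundary n ?H (\<lambda>as b. T (as @ [b])) as b
    = lact X (as ! 0) (T (drop 1 as @ [b])) \<oplus> s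
      \<oplus> c \<odot> (T (take n as @ [as ! n * b]) \<ominus> ract X (T (take n as @ [as ! n])) b)"
    by (simp add: coboundary_def c_def)
  also have "take n as @ [as ! n] = as"
    using as by (metis lessI order_refl take_Suc_conv_app_nth take_all)
  also have "coboundary n ?H (\<lambda>as b. T (as @ [b])) as = (\<lambda>_. \<zero>)"
    using coc as by (simp add: cocycle_def)
  finally have 0: "lact X (as ! 0) (T (drop 1 as @ [b])) \<oplus> s
      \<oplus> c \<odot> (T (take n as @ [as ! n * b]) \<ominus> ract X (T as) b) = \<zero>" ..
  have "(\<Oplus>j\<in>{1..Suc n}. (- 1) ^ j \<odot> T (merge_args j cs))
    = c \<odot> T (merge_args (Suc n) cs) \<oplus> (\<Oplus>j\<in>{1..n}. (- 1) ^ j \<odot> T (merge_args j cs))"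
    using as by (subst atLeastAtMostSuc_conv, simp, subst M.finsum_insert) (auto simp: c_def cs)
  also have "(\<Oplus>j\<in>{1..n}. (- 1) ^ j \<odot> T (merge_args j cs)) = s"
    unfolding s_def using as by (intro M.finsum_cong') (auto simp: cs merge_args_append)
  also have "merge_args (Suc n) cs = take n as @ [as ! n * b]"
    using as by (simp add: cs merge_args_snoc)
  finally have "coboundary (Suc n) X T cs = lact X (as ! 0) (T (drop 1 as @ [b]))
    \<oplus> (c \<odot> T (take n as @ [as ! n * b]) \<oplus> s) \<oplus> (- c) \<odot> ract X (T as) b"
    using as by (simp add: coboundary_def cs nth_append c_def)
  also have "\<dots> = lact X (as ! 0) (T (drop 1 as @ [b])) \<oplus> s
      \<oplus> c \<odot> (T (take n as @ [as ! n * b]) \<ominus> ract X (T as) b)"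
    using as s smult_l_minus[of c "ract X (T as) b"]
    by (simp add: smult_r_distr[simplified]
        smult_r_minus lact_closed ract_closed a_minus_def M.a_ac)
  finally show "coboundary (Suc n) X T cs = \<zero>"
    using 0 by simp
qed

section \<open>Induction on the number of arguments\<close>

lemma normalised_hyperlocal_imp_cocycle_list_carrier:
  fixes X :: "('b::{complex_banach_algebra, real_normed_algebra_1}, 'b list \<Rightarrow> 'x) bimodule"
  assumes cond_i: "\<And>(Y :: ('b, 'b list \<Rightarrow> 'x) bimodule) D.
      \<lbrakk>unital_banach_bimodule Y; bounded_operator Y D\<rbrakk>
      \<Longrightarrow> left_multiplier Y D \<longleftrightarrow> (\<forall>a b. b * a = 0 \<longrightarrow> ract Y (D b) a = \<zero>\<^bsub>Y\<^esub>)"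
    and cond_ii: "\<And>(Y :: ('b, 'b list \<Rightarrow> 'x) bimodule) D.
      \<lbrakk>unital_banach_bimodule Y; bounded_operator Y D\<rbrakk>
      \<Longrightarrow> hyperlocal Y D \<longleftrightarrow>
        (\<forall>a b c. D (a * c * b) \<ominus>\<^bsub>Y\<^esub> lact Y a (D (c * b)) \<ominus>\<^bsub>Y\<^esub> ract Y (D (a * c)) b
          \<oplus>\<^bsub>Y\<^esub> lact Y a (ract Y (D c) b) = \<zero>\<^bsub>Y\<^esub>)"
    and X: "unital_banach_bimodule X" and T: "normalised_hyperlocal (Suc n) X T"
  shows "cocycle (Suc n) X T"
  using X T
\<comment> \<open>The bimodule must vary, since the step passes to a recoding of
  \<open>hom_bimodule X\<close>. The shift to \<open>Suc n\<close> starts the induction at one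
  argument.\<close>
proof (induction n arbitrary: X T)
  case 0
  interpret unital_banach_bimodule X by fact
  show ?case
    using normalised_hyperlocal_imp_cocycle_1 cond_ii 0 by simp
next
  case (Suc n)
  interpret unital_banach_bimodule X by fact
  let ?H = "hom_bimodule X" and ?T = "\<lambda>as b. T (as @ [b])"
  interpret H: unital_banach_bimodule ?H
    by (rule unital_banach_bimodule_hom) fact
  \<comment> \<open>Maps from \<^typ>\<open>'b\<close> to \<^typ>\<open>'b list \<Rightarrow> 'x\<close> are coded in \<^typ>\<open>'b list \<Rightarrow> 'x\<close>, so that the
    induction never leaves this carrier type.\<close>
  define f :: "('b \<Rightarrow> 'b list \<Rightarrow> 'x) \<Rightarrow> 'b list \<Rightarrow> 'x"
    where "f S as = (case as of [] \<Rightarrow> undefined | a # as \<Rightarrow> S a as)" for S as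
  \<comment> \<open>\<open>f\<close> uncurries: its values at nonempty lists recover
    \<open>S\<close>.\<close>
  have "S = S'" if "f S = f S'" for S S'
  proof (intro ext)
    show "S a as = S' a as" for a as
      using fun_cong[OF that, of "a # as"] by (simp add: f_def)
  qed
  then have f: "inj_on f (carrier ?H)"
    by (auto intro: inj_onI)
  have lin: "n_linear (Suc (Suc n)) X T"
    using Suc.prems by (simp add: normalised_hyperlocal_def bounded_n_linear_def)
  have T': "normalised_hyperlocal (Suc n) ?H ?T"
    using Suc.prems cond_i by (intro normalised_hyperlocal_snoc) auto
  then have lin': "n_linear (Suc n) ?H ?T"
    by (simp add: normalised_hyperlocal_def bounded_n_linear_def)
  have "cocycle (Suc n) (H.transported (carrier ?H) f) (f \<circ> ?T)"
    using H.unital_banach_bimodule_transported[OF f] H.normalised_hyperlocal_transported[OF f T']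
    by (rule Suc.IH)
  then have "cocycle (Suc n) ?H ?T"
    by (rule H.cocycle_transportedD[OF f lin'])
  then show ?case
    using H.n_linear_closed[OF lin'] by (intro cocycle_snocD lin) simp_all
qed

text \<open>An arbitrary carrier type \<open>'x\<close> embeds into
  \<open>'b list \<Rightarrow> 'x\<close> by constant functions, so the result for that type
  transfers.\<close>

lemma normalised_hyperlocal_imp_cocycle:
  fixes X :: "('b::{complex_banach_algebra, real_normed_algebra_1}, 'x) bimodule"
  assumes cond_i: "\<And>(Y :: ('b, 'b list \<Rightarrow> 'x) bimodule) D.
      \<lbrakk>unital_banach_bimodule Y; bounded_operator Y D\<rbrakk>
      \<Longrightarrow> left_multiplier Y D \<longleftrightarrow> (\<forall>a b. b * a = 0 \<longrightarrow> ract Y (D b) a = \<zero>\<^bsub>Y\<^esub>)"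
    and cond_ii: "\<And>(Y :: ('b, 'b list \<Rightarrow> 'x) bimodule) D.
      \<lbrakk>unital_banach_bimodule Y; bounded_operator Y D\<rbrakk>
      \<Longrightarrow> hyperlocal Y D \<longleftrightarrow>
        (\<forall>a b c. D (a * c * b) \<ominus>\<^bsub>Y\<^esub> lact Y a (D (c * b)) \<ominus>\<^bsub>Y\<^esub> ract Y (D (a * c)) b
          \<oplus>\<^bsub>Y\<^esub> lact Y a (ract Y (D c) b) = \<zero>\<^bsub>Y\<^esub>)"
    and X: "unital_banach_bimodule X" and n: "n \<ge> 1" and T: "normalised_hyperlocal n X T"
  shows "cocycle n X T"
proof -
  interpret unital_banach_bimodule X by fact
  obtain m where m: "n = Suc m"
    using n by (cases n) auto
  define f :: "'x \<Rightarrow> 'b list \<Rightarrow> 'x" where "f x = (\<lambda>_. x)" for x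
  have f: "inj_on f (carrier X)"
    by (intro inj_onI) (simp add: f_def fun_eq_iff)
  have "cocycle (Suc m) (transported (carrier X) f) (f \<circ> T)"
    by (rule normalised_hyperlocal_imp_cocycle_list_carrier[OF cond_i cond_ii
          unital_banach_bimodule_transported[OF f] normalised_hyperlocal_transported[OF f]])
      (use T m in simp_all)
  then show ?thesis
    unfolding m by (rule cocycle_transportedD[OF f, rotated])
      (use T m in \<open>simp add: normalised_hyperlocal_def bounded_n_linear_def\<close>)
qed

section \<open>Passage to the unitization\<close>

text \<open>The only linear extension of the two actions for which 1 acts as the identity.\<close>

definition unitization_bimodule ::
    "('a::complex_banach_algebra, 'x) bimodule \<Rightarrow> ('a unitization, 'x) bimodule" where
  "unitization_bimodule X =
    \<lparr>carrier = carrier X, mult = undefined, one = undefined, zero = \<zero>\<^bsub>X\<^esub>,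
     add = (\<lambda>x y. x \<oplus>\<^bsub>X\<^esub> y), smult = (\<lambda>c x. c \<odot>\<^bsub>X\<^esub> x), vnorm = vnorm X,
     lact = (\<lambda>u x. lact X (algebra_part u) x \<oplus>\<^bsub>X\<^esub> scalar_part u \<odot>\<^bsub>X\<^esub> x),
     ract = (\<lambda>x u. ract X x (algebra_part u) \<oplus>\<^bsub>X\<^esub> scalar_part u \<odot>\<^bsub>X\<^esub> x)\<rparr>"

lemma unitization_bimodule_simps [simp]:
  "carrier (unitization_bimodule X) = carrier X"
  "zero (unitization_bimodule X) = \<zero>\<^bsub>X\<^esub>"
  "add (unitization_bimodule X) x y = x \<oplus>\<^bsub>X\<^esub> y"
  "smult (unitization_bimodule X) c x = c \<odot>\<^bsub>X\<^esub> x"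
  "vnorm (unitization_bimodule X) = vnorm X"
  "lact (unitization_bimodule X) u x = lact X (algebra_part u) x \<oplus>\<^bsub>X\<^esub> scalar_part u \<odot>\<^bsub>X\<^esub> x"
  "ract (unitization_bimodule X) x u = ract X x (algebra_part u) \<oplus>\<^bsub>X\<^esub> scalar_part u \<odot>\<^bsub>X\<^esub> x"
  by (simp_all add: unitization_bimodule_def)

lemma unitization_part_simps [simp]:
  "algebra_part (u + v) = algebra_part u + algebra_part v"
  "scalar_part (u + v) = scalar_part u + scalar_part v"
  "algebra_part (u * v) = algebra_part u * algebra_part v + scalar_part v *\<^sub>C algebra_part u
    + scalar_part u *\<^sub>C algebra_part v"
  "scalar_part (u * v) = scalar_part u * scalar_part v"
  "algebra_part (c *\<^sub>C u) = c *\<^sub>C algebra_part u"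
  "scalar_part (c *\<^sub>C u) = c * scalar_part u"
  "algebra_part 0 = 0" "scalar_part 0 = 0" "algebra_part 1 = 0" "scalar_part 1 = 1"
  by (simp_all add: unitization_defs scaleC_unitization_def one_unitization_def)

lemma scaleC_minus_left: "(- c) *\<^sub>C x = - (c *\<^sub>C x :: 'a::complex_banach_algebra)"
  using scaleC_add_left[of c "- c" x] by (simp add: eq_neg_iff_add_eq_0 add.commute)

lemma (in banach_bimodule) unital_banach_bimodule_unitization:
  "unital_banach_bimodule (unitization_bimodule X)"
proof -
  let ?U = "unitization_bimodule X"
  have ag: "abelian_group ?U"
    by (rule abelian_groupI) (auto simp: M.a_ac intro: M.a_inv_closed M.l_neg)
  have mod: "Module.module complex_field ?U"
    by (rule moduleI[OF cring_complex_field ag])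
      (auto simp: smult_l_distr[simplified] smult_r_distr[simplified] smult_assoc1[simplified]
          smult_one[simplified])
  interpret U: abelian_group ?U by (rule ag)
  have "\<ominus>\<^bsub>?U\<^esub> x = \<ominus> x" if "x \<in> carrier X" for x
    using that by (intro U.minus_equality) (auto simp: M.l_neg)
  then have minus: "x \<ominus>\<^bsub>?U\<^esub> y = x \<ominus> y" if "y \<in> carrier X" for x y
    using that by (simp add: a_minus_def)
  note [simp] = lact_closed ract_closed
  note distribs = smult_l_distr[simplified] smult_r_distr[simplified]
      smult_assoc1[simplified, symmetric]
    smult_one[simplified] lact_add_left lact_add_right lact_scaleC lact_smult lact_mult
    ract_add_left ract_add_right ract_scaleC ract_smult ract_mult lact_ract M.a_ac mult.commute
  obtain Kl where Kl: "0 \<le> Kl"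
      "\<And>a x. x \<in> carrier X \<Longrightarrow> vnorm X (lact X a x) \<le> Kl * norm a * vnorm X x"
    using lact_bounded' by blast
  obtain Kr where Kr: "0 \<le> Kr"
      "\<And>a x. x \<in> carrier X \<Longrightarrow> vnorm X (ract X x a) \<le> Kr * norm a * vnorm X x"
    using ract_bounded' by blast
  \<comment> \<open>One estimate for both actions, with \<open>y\<close> the value of the original
    action. The scalar part adds 1 to the constant.\<close>
  have bound: "vnorm X (y \<oplus> scalar_part u \<odot> x) \<le> (K + 1) * norm u * vnorm X x"
    if "x \<in> carrier X" "y \<in> carrier X" "0 \<le> K" "vnorm X y \<le> K * norm (algebra_part u) * vnorm X x"
    for x y u and K :: real
  proof -
    have "vnorm X (y \<oplus> scalar_part u \<odot> x)
        \<le> K * norm (algebra_part u) * vnorm X x + cmod (scalar_part u) * vnorm X x"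
      using vnorm_triangle[of y "scalar_part u \<odot> x"] that by (simp add: vnorm_smult)
    also have "\<dots> \<le> (K + 1) * norm u * vnorm X x"
      using that vnorm_nonneg[of x] by (simp add: norm_unitization_def algebra_simps)
    finally show ?thesis .
  qed
  have "banach_bimodule ?U"
  \<comment> \<open>In the order of the locale axioms, case 4 is completeness, and 11 and 18 are the
    bounds for the two actions.\<close>
  proof (intro banach_bimodule.intro mod banach_bimodule_axioms.intro, goal_cases)
    case (4 s)
    then show ?case
      using complete[of s] by (simp add: minus)
  next
    case 11
    then show ?case
      using bound[OF _ _ Kl(1) Kl(2)] by (intro exI[of _ "Kl + 1"]) auto
  next
    case 18
    then show ?case
      using bound[OF _ _ Kr(1) Kr(2)] by (intro exI[of _ "Kr + 1"]) auto
  qed (auto simp: vnorm_eq_0 vnorm_triangle vnorm_smult distribs)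
  then show ?thesis
    by (intro unital_banach_bimodule.intro unital_banach_bimodule_axioms.intro)
      (auto simp: smult_one[simplified])
qed

section \<open>The zero product property of local cocycles\<close>

lemma (in banach_bimodule) finsum_telescope:
  fixes n :: nat
  assumes "\<And>j. j \<le> n \<Longrightarrow> g j \<in> carrier X"
  shows "(\<Oplus>j\<in>{1..n}. g (j - 1) \<ominus> g j) = g 0 \<ominus> g n"
  using assms
proof (induction n)
  case 0
  then show ?case by (simp add: diff_self)
next
  case (Suc n)
  have "(\<Oplus>j\<in>{1..Suc n}. g (j - 1) \<ominus> g j) = (g n \<ominus> g (Suc n)) \<oplus> (\<Oplus>j\<in>{1..n}. g (j - 1) \<ominus> g j)"
    using Suc.prems by (subst atLeastAtMostSuc_conv, simp, subst M.finsum_insert) auto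
  then show ?case
    using Suc by (simp add: a_minus_def M.a_ac M.r_neg1 M.r_neg2)
qed

text \<open>
  When consecutive products of the arguments vanish in the unitization, each product of two
  neighbouring algebra parts is a combination of the two, so the inner terms of the coboundary
  telescope.
\<close>

lemma (in banach_bimodule) cocycle_hyperlocal_unitization:
  assumes S: "cocycle n X S" and us: "length us = n"
    and succ: "successively (\<lambda>x y. x * y = 0) (u # us @ [v])"
  shows "lact (unitization_bimodule X) u (ract (unitization_bimodule X) (S (map algebra_part us)) v) = \<zero>"
proof -
  let ?U = "unitization_bimodule X"
  interpret U: unital_banach_bimodule ?U
    by (rule unital_banach_bimodule_unitization)
  have lin: "n_linear n X S" and cob: "\<And>as. length as = n + 1 \<Longrightarrow> coboundary n X S as = \<zero>"
    using S by (simp_all add: cocycle_def)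
  define ws where "ws = u # us"
  define as where "as = map algebra_part ws"
  \<comment> \<open>The coboundary is taken at the \<open>n + 1\<close> algebra parts of
    \<open>u # us\<close>. \<open>R j\<close> omits entry \<open>j\<close>, and \<open>g j\<close>
    weights it with its sign and the scalar part of the omitted entry.\<close>
  define l where "l j = scalar_part (ws ! j)" for j
  define R where "R j = S (take j as @ drop (Suc j) as)" for j
  define g where "g j = ((- 1) ^ j * l j) \<odot> R j" for j
  have len: "length ws = Suc n" "length as = Suc n"
    using us by (simp_all add: ws_def as_def)
  have R: "R j \<in> carrier X" if "j \<le> n" for j
    unfolding R_def using that len by (intro n_linear_closed[OF lin]) simp
  then have g: "g j \<in> carrier X" if "j \<le> n" for j
    using that by (simp add: g_def)
  have "last ws = ws ! n"
    using len last_conv_nth[of ws] by (cases ws) auto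
  then have ends: "as ! 0 = algebra_part u" "l 0 = scalar_part u"
    "as ! n = algebra_part (last ws)" "l n = scalar_part (last ws)"
    using len by (simp_all add: as_def l_def) (simp_all add: ws_def)
  have succ': "successively (\<lambda>x y. x * y = 0) ws" "last ws * v = 0"
    using succ successively_append_iff[of _ "u # us" "[v]"] by (auto simp: ws_def)
  have "(- 1) ^ j \<odot> S (merge_args j as) = g (j - 1) \<ominus> g j" if j: "j \<in> {1..n}" for j
  proof -
    obtain i where i: "j = Suc i" "i < n"
      using j by (cases j) auto
    have "ws ! i * ws ! Suc i = 0"
      using succ'(1) i len by (simp add: successively_conv_nth)
    then have "algebra_part (ws ! i * ws ! Suc i) = 0"
      by simp
    then have prod: "as ! i * as ! Suc i = (- l (Suc i)) *\<^sub>C as ! i + (- l i) *\<^sub>C as ! Suc i"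
      using i len by (simp add: as_def l_def scaleC_minus_left eq_neg_iff_add_eq_0 add_ac
      eq_diff_eq)
    \<comment> \<open>A list with a free slot for the merged entry. Filling it with entry
      \<open>i\<close> omits entry \<open>Suc i\<close>, and conversely, so linearity in this slot
      yields \<open>R (Suc i)\<close> and \<open>R i\<close>.\<close>
    define bs where "bs = take i as @ [0] @ drop (Suc (Suc i)) as"
    have bs: "length bs = n" "bs[i := x] = take i as @ [x] @ drop (Suc (Suc i)) as" for x
      using i len by (simp_all add: bs_def list_update_append)
    have "merge_args j as = bs[i := as ! i * as ! Suc i]"
      unfolding bs by (simp add: merge_args_def i)
    then have "S (merge_args j as) = (- l (Suc i)) \<odot> S (bs[i := as ! i])
        \<oplus> (- l i) \<odot> S (bs[i := as ! Suc i])"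
      using lin bs(1) i(2) unfolding prod by (simp add: n_linear_def)
    also have "bs[i := as ! i] = take (Suc i) as @ drop (Suc (Suc i)) as"
      unfolding bs using i len by (simp add: take_Suc_conv_app_nth)
    also have "bs[i := as ! Suc i] = take i as @ drop (Suc i) as"
      unfolding bs using i len Cons_nth_drop_Suc[of "Suc i" as] by simp
    finally have "S (merge_args j as) = (- l (Suc i)) \<odot> R (Suc i) \<oplus> (- l i) \<odot> R i"
      by (simp only: R_def)
    then show ?thesis
      using R[of i] R[of "Suc i"] i
      by (simp add: diff_eq_smult g_def smult_r_distr[simplified]
          smult_assoc1[simplified, symmetric] M.a_ac)
  qed
  then have "(\<Oplus>j\<in>{1..n}. (- 1) ^ j \<odot> S (merge_args j as)) = (\<Oplus>j\<in>{1..n}. g (j - 1) \<ominus> g j)"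
    using g by (intro M.finsum_cong') auto
  also have "\<dots> = g 0 \<ominus> g n"
    by (rule finsum_telescope) (rule g)
  finally have "coboundary n X S as = lact X (as ! 0) (R 0) \<oplus> (g 0 \<ominus> g n)
      \<oplus> (- 1) ^ (n + 1) \<odot> ract X (R n) (as ! n)"
    using len by (simp add: coboundary_def R_def)
  \<comment> \<open>The boundary terms of the telescope are the scalar contributions that complete
    the outer terms to actions of the unitization.\<close>
  also have "\<dots> = (lact X (as ! 0) (R 0) \<oplus> l 0 \<odot> R 0) \<ominus> (- 1) ^ n \<odot> (ract X (R n) (as ! n)
      \<oplus> l n \<odot> R n)"
    using R[of 0] R[of n] lact_closed ract_closed
    by (simp add: diff_eq_smult g_def smult_r_distr[simplified] smult_assoc1[simplified, symmetric]
        M.a_ac)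
  also have "\<dots> = lact ?U u (R 0) \<ominus> (- 1) ^ n \<odot> ract ?U (R n) (last ws)"
    by (simp add: ends)
  finally have 0: "lact ?U u (R 0) \<ominus> (- 1) ^ n \<odot> ract ?U (R n) (last ws) = \<zero>"
    using cob[of as] len by simp
  have cl: "lact ?U u (R 0) \<in> carrier X" "ract ?U (R n) (last ws) \<in> carrier X"
    using U.lact_closed[of "R 0" u] U.ract_closed[of "R n" "last ws"] R[of 0] R[of n]
    by (simp_all del: unitization_bimodule_simps(6,7))
  have eq: "lact ?U u (R 0) = (- 1) ^ n \<odot> ract ?U (R n) (last ws)"
    by (rule diff_eq_zeroD[OF cl(1) smult_closed'[OF cl(2)] 0])
  \<comment> \<open>Multiplying the relation by \<open>v\<close> on the right creates the factor
    \<open>last ws * v\<close>, which is zero.\<close>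
  have "ract ?U (lact ?U u (R 0)) v = (- 1) ^ n \<odot> ract ?U (R n) (last ws * v)"
    unfolding eq
    using U.ract_smult[of "ract ?U (R n) (last ws)" "(- 1) ^ n" v]
      U.ract_mult[of "R n" "last ws" v] R[of n] cl(2)
    by (simp del: unitization_bimodule_simps(6,7))
  then have "ract ?U (lact ?U u (R 0)) v = \<zero>"
    using U.ract_by_zero[of "R n"] R[of n] smult_r_null succ'(2)
    by (simp del: unitization_bimodule_simps(6,7))
  moreover have "R 0 = S (map algebra_part us)"
    by (simp add: R_def as_def ws_def)
  ultimately show ?thesis
    using U.lact_ract[of "R 0" u v] R[of 0] by (simp del: unitization_bimodule_simps(6,7))
qed

text \<open>The zero product condition involves only the value at one point, where \<open>T\<close>
  agrees with some cocycle; the choice of cocycle may change with the point. Vanishing at 1 holds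
  because \<open>algebra_part 1 = 0\<close>.\<close>

lemma (in banach_bimodule) local_cocycle_normalised_hyperlocal:
  assumes n: "n \<ge> 1" and T: "bounded_local_cocycle n X T"
  shows "normalised_hyperlocal n (unitization_bimodule X) (\<lambda>us. T (map algebra_part us))"
proof -
  let ?T = "\<lambda>us. T (map algebra_part us)"
  obtain K where lin: "n_linear n X T"
    and K: "\<And>as. length as = n \<Longrightarrow> vnorm X (T as) \<le> K * (\<Prod>a\<leftarrow>as. norm a)"
    and loc: "\<And>as. length as = n \<Longrightarrow> \<exists>S. cocycle n X S \<and> T as = S as"
    using T by (auto simp: bounded_local_cocycle_def bounded_n_linear_def local_cocycle_def)
  have prod_nonneg: "0 \<le> (\<Prod>u\<leftarrow>us. norm (f u))"
      for us :: "'b unitization list" and f :: "_ \<Rightarrow> 'z::real_normed_vector"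
    by (induction us) auto
  have prod_le: "(\<Prod>u\<leftarrow>us. norm (algebra_part u)) \<le> (\<Prod>u\<leftarrow>us. norm u)" for us :: "'b unitization list"
    by (induction us) (auto simp: norm_unitization_def intro!: mult_mono add_nonneg_nonneg prod_nonneg)
  have "n_linear n (unitization_bimodule X) ?T"
    using lin by (simp add: n_linear_def map_update)
  moreover have "vnorm X (?T us) \<le> max K 0 * (\<Prod>u\<leftarrow>us. norm u)" if "length us = n" for us
  proof -
    have "vnorm X (?T us) \<le> K * (\<Prod>u\<leftarrow>us. norm (algebra_part u))"
      using K[of "map algebra_part us"] that by (simp add: comp_def)
    also have "\<dots> \<le> max K 0 * (\<Prod>u\<leftarrow>us. norm u)"
      by (intro mult_mono prod_le prod_nonneg) auto
    finally show ?thesis .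
  qed
  moreover have "?T us = \<zero>" if us: "length us = n" "1 \<in> set us" for us
  proof -
    obtain i where i: "i < n" "us ! i = 1"
      using us by (metis in_set_conv_nth)
    define as where "as = map algebra_part us"
    \<comment> \<open>Writing the zero entry as \<open>0 *\<^sub>C 0\<close> lets homogeneity give
      the value zero.\<close>
    have as: "length as = n" "as[i := 0 *\<^sub>C 0] = as"
      using i us list_update_id[of as i] by (simp_all add: as_def)
    then have "T as = 0 \<odot> T (as[i := 0])"
      using lin i unfolding n_linear_def by metis
    then show ?thesis
      using n_linear_closed[OF lin, of "as[i := 0]"] as smult_l_null by (simp add: as_def)
  qed
  moreover have "lact (unitization_bimodule X) u (ract (unitization_bimodule X) (?T us) v) = \<zero>"
    if us: "length us = n" "successively (\<lambda>x y. x * y = 0) (u # us @ [v])" for u us v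
    using loc[of "map algebra_part us"] cocycle_hyperlocal_unitization[OF _ us] us by auto
  ultimately show ?thesis
    unfolding normalised_hyperlocal_def bounded_n_linear_def by auto
qed

section \<open>Descent of the cocycle identity from the unitization to the algebra\<close>

theorem theorem2p3:
  fixes X :: "('a::complex_banach_algebra, 'x) bimodule"
    and n :: nat
    and T :: "'a list \<Rightarrow> 'x"
  assumes cond_i:
    "\<And>(Y :: ('a unitization, 'a unitization bimodule_universe) bimodule) D.
      \<lbrakk>unital_banach_bimodule Y; bounded_operator Y D\<rbrakk>
      \<Longrightarrow> left_multiplier Y D \<longleftrightarrow> (\<forall>a b. b * a = 0 \<longrightarrow> ract Y (D b) a = \<zero>\<^bsub>Y\<^esub>)"
    and cond_ii:
    "\<And>(Y :: ('a unitization, 'a unitization bimodule_universe) bimodule) D.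
      \<lbrakk>unital_banach_bimodule Y; bounded_operator Y D\<rbrakk>
      \<Longrightarrow> hyperlocal Y D \<longleftrightarrow>
        (\<forall>a b c. D (a * c * b) \<ominus>\<^bsub>Y\<^esub> lact Y a (D (c * b)) \<ominus>\<^bsub>Y\<^esub> ract Y (D (a * c)) b
          \<oplus>\<^bsub>Y\<^esub> lact Y a (ract Y (D c) b) = \<zero>\<^bsub>Y\<^esub>)"
    and X: "banach_bimodule X"
    and n: "n \<ge> 1"
    and T: "bounded_local_cocycle n X T"
  shows "cocycle n X T"
proof -
  interpret banach_bimodule X by (rule X)
  let ?U = "unitization_bimodule X" and ?T = "\<lambda>us. T (map algebra_part us)"
  interpret U: unital_banach_bimodule ?U
    by (rule unital_banach_bimodule_unitization)
  have lin: "n_linear n X T"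
    using T by (simp add: bounded_local_cocycle_def local_cocycle_def)
  \<comment> \<open>The two conditions are first carried over from the universe type to the function
    type on which the induction runs.\<close>
  have "cocycle n ?U ?T"
    by (rule normalised_hyperlocal_imp_cocycle[OF
          left_multiplier_condition_any_carrier[OF cond_i]
              hyperlocal_condition_any_carrier[OF cond_ii]
          U.unital_banach_bimodule_axioms n local_cocycle_normalised_hyperlocal[OF n T]])
  then have cob: "coboundary n ?U ?T us = \<zero>\<^bsub>X\<^esub>" if "length us = n + 1" for us
    using that by (simp add: cocycle_def)
  have "coboundary n X T as = \<zero>\<^bsub>X\<^esub>" if as: "length as = n + 1" for as
  proof -
    \<comment> \<open>The embedding of \<open>a\<close> as (a, 0) is multiplicative, and the
      extended actions restrict along it to the original ones.\<close>
    have "coboundary n ?U ?T (map (\<lambda>a. Unitization a 0) as) = coboundary n X T as"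
      by (rule coboundary_map)
        (use lin as smult_l_null in \<open>auto simp: X U.banach_bimodule_axioms lact_closed ract_closed
          times_unitization_def n_linear_closed comp_def\<close>)
    then show ?thesis
      using cob[of "map (\<lambda>a. Unitization a 0) as"] as by simp
  qed
  then show ?thesis
    by (simp add: cocycle_def lin)
qed

end
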